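(* Let $(\mathsf{Z},\mathsf{A},p,c)$ be a Markov decision process such that: $\mathsf{A}$ is compact; $\mathsf{Z}$ is an infinite compact subset of $\mathbb{R}^d$ for some $d\ge1$, equipped with the Euclidean metric $d_{\mathsf{Z}}$; $c$ is a bounded continuous function on $\mathsf{Z}\times\mathsf{A}$; $p(\,\cdot\,|z,a)$ is continuous in $(z,a)$ with respect to the total variation distance; and there exist a non-trivial finite measure $\zeta$ on $\mathsf{Z}$, a nonnegative measurable function $\theta$ on $\mathsf{Z}\times\mathsf{A}$ and $\lambda\in(0,1)$ such that for all $(z,a)$, $p(B|z,a)\ge\zeta(B)\theta(z,a)$ for all Borel $B\subset\mathsf{Z}$ and $\frac{1-\lambda}{\zeta(\mathsf{Z})}\le\theta(z,a)$. Let $\alpha>0$ and let $\mathsf{Z}_n\subset\mathsf{Z}$ ($n\ge1$) be finite sets with $n$ elements satisfying $\max_{z\in\mathsf{Z}}\min_{y\in\mathsf{Z}_n}d_{\mathsf{Z}}(z,y)\le\alpha(1/n)^{1/d}$, and put $d_n=2\alpha(1/n)^{1/d}$. Let MDP$_n$ be the finite-state model on $\mathsf{Z}_n$ described in the context, $f_n^*$ an optimal deterministic stationary policy of MDP$_n$ for the average cost, and $\tilde f_n^*=f_n^*\circ Q_n$. Let $R>0$ and $\kappa\in(0,1)$ be the uniform geometric ergodicity constants of the context. Then for all $n\ge1$ and all $t\ge1$, $$|\rho_{\tilde f_n^*}-\rho_{f^*}|\le4\|c\|R\kappa^t+2\,\omega_c(d_n)+2\|c\|\,t\,\omega_p(d_n),$$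 where $\rho_{\tilde f_n^*}$ is the average cost of $\tilde f_n^*$ in the original MDP and $\rho_{f^*}$ is the average-cost value function of the original MDP.
   Context: A Markov decision process (MDP) $(\mathsf{Z},\mathsf{A},p,c)$ consists of Borel spaces $\mathsf{Z}$ (states) and $\mathsf{A}$ (actions, all admissible in every state), a stochastic kernel $p(dy|z,a)$ on $\mathsf{Z}$ given $\mathsf{Z}\times\mathsf{A}$, and a measurable one-stage cost $c:\mathsf{Z}\times\mathsf{A}\to\mathbb{R}$. A deterministic stationary policy is a measurable function $f$ from states to actions, applied as $a_t=f(z_t)$; $\mathbb{F}$ is the set of all measurable $f:\mathsf{Z}\to\mathsf{A}$. The average cost of a (history-dependent, randomized) policy $\pi$ is $V(\pi,z)=\limsup_T\frac1T\mathbb{E}_z^\pi[\sum_{t=0}^{T-1}c(z_t,a_t)]$. Under the hypotheses each $f\in\mathbb{F}$ has a unique invariant probability measure $\mu_f$ for $p(\cdot|z,f(z))$, $V(f,z)=\rho_f:=\int c(z,f(z))\mu_f(dz)$ for all $z$, and there is an optimal $f^*\in\mathbb{F}$, with $\inf_\pi V(\pi,z)=\rho_{f^*}$ for all $z$; similarly for MDP$_n$. $\|c\|$ is the sup norm; $\|\mu-\nu\|_{TV}=2\sup_D|\mu(D)-\nu(D)|=\sup_{\|g\|\le1}|\int g\,d\mu-\int g\,d\nu|$. Moduli of continuity: $\omega_c(r)=\sup_{a}\sup_{d_{\mathsf{Z}}(z,y)\le r}|c(z,a)-c(y,a)|$ and $\omega_p(r)=\sup_{a}\sup_{d_{\mathsf{Z}}(z,y)\le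 r}\|p(\cdot|z,a)-p(\cdot|y,a)\|_{TV}$. Finite-state models: write $\mathsf{Z}_n=\{z_{n,1},\dots,z_{n,n}\}$. $Q_n:\mathsf{Z}\to\mathsf{Z}_n$ is the nearest-neighbour map, ties broken so that $Q_n$ is measurable; $\mathcal{S}_{n,i}=\{z:Q_n(z)=z_{n,i}\}$; $i_n(z)$ is the index $i$ with $z\in\mathcal{S}_{n,i}$. $\nu_n$ is any probability measure on $\mathsf{Z}$ with $\nu_n(\mathcal{S}_{n,i})>0$ for all $i$, and $\nu_{n,i}(\cdot)=\nu_n(\cdot)/\nu_n(\mathcal{S}_{n,i})$ on $\mathcal{S}_{n,i}$. MDP$_n$ has state space $\mathsf{Z}_n$, action space $\mathsf{A}$, one-stage cost $c_n(z_{n,i},a)=\int_{\mathcal{S}_{n,i}}c(z,a)\,\nu_{n,i}(dz)$ and transition probability $p_n(z_{n,j}|z_{n,i},a)=\int_{\mathcal{S}_{n,i}}p(\mathcal{S}_{n,j}|z,a)\,\nu_{n,i}(dz)$. Ergodicity constants: let $q_n(\cdot|z,a)=\int p(\cdot|x,a)\,\nu_{n,i_n(z)}(dx)$, and let $p^t(\cdot|z,f(z))$, $q_n^t(\cdot|z,f(z))$ be the $t$-step transition probabilities of the chains with kernels $p(\cdot|z,f(z))$, $q_n(\cdot|z,f(z))$, with invariant probabilities $\mu_f$, $\hat\mu_f^n$. $R>0$ and $\kappa\in(0,1)$ are constants with $\sup_{f\in\mathbb{F}}\|p^t(\cdot|z,f(z))-\mu_f\|_{TV}\le R\kappa^t$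 and $\sup_{f\in\mathbb{F}}\|q_n^t(\cdot|z,f(z))-\hat\mu^n_f\|_{TV}\le R\kappa^t$ for all $z\in\mathsf{Z}$, $t\ge1$, $n\ge1$; such constants exist under the hypotheses. *)

theory Defs
  imports "HOL-Probability.Probability"
begin

section \<open>Markov decision processes on Borel spaces\<close>

abbreviation borel_on :: "'a::topological_space set \<Rightarrow> 'a measure" where
  "borel_on X \<equiv> restrict_space borel X"

text \<open>A Borel space is a Borel subset of a Polish space. Functions are total in HOL; only the
  values of \<open>p\<close> and \<open>c\<close> on \<open>Z \<times> A\<close> matter, and a measurable map into
  \<open>prob_algebra (borel_on Z)\<close> is exactly a stochastic kernel on \<open>Z\<close>.\<close>

locale MDP =
  fixes Z :: "'z::polish_space set" and A :: "'a::polish_space set"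
    and p :: "'z \<Rightarrow> 'a \<Rightarrow> 'z measure" and c :: "'z \<Rightarrow> 'a \<Rightarrow> real"
  assumes Z_borel: "Z \<in> sets borel" and Z_nonempty: "Z \<noteq> {}"
    and A_borel: "A \<in> sets borel" and A_nonempty: "A \<noteq> {}"
    and kernel: "(\<lambda>(z, a). p z a) \<in> borel_on Z \<Otimes>\<^sub>M borel_on A \<rightarrow>\<^sub>M prob_algebra (borel_on Z)"
    and cost: "(\<lambda>(z, a). c z a) \<in> borel_on Z \<Otimes>\<^sub>M borel_on A \<rightarrow>\<^sub>M borel"

text \<open>Deterministic stationary policies (the set \<open>\<bbbF>\<close>).\<close>

definition det_stationary :: "'z::polish_space set \<Rightarrow> 'a::polish_space set \<Rightarrow> ('z \<Rightarrow> 'a) set" where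
  "det_stationary Z A = borel_on Z \<rightarrow>\<^sub>M borel_on A"

text \<open>History-dependent randomized policies: \<open>\<pi> t h z\<close> is the distribution of the action at time
  \<open>t\<close>, given the past \<open>h 0, \<dots>, h (t - 1)\<close> of state-action pairs and the current state \<open>z\<close>.\<close>

type_synonym ('z, 'a) policy = "nat \<Rightarrow> (nat \<Rightarrow> 'z \<times> 'a) \<Rightarrow> 'z \<Rightarrow> 'a measure"

definition policies :: "'z::polish_space set \<Rightarrow> 'a::polish_space set \<Rightarrow> ('z, 'a) policy set" where
  "policies Z A = {\<pi>. \<forall>t. (\<lambda>(h, z). \<pi> t h z) \<in>
     PiM {0..<t} (\<lambda>_. borel_on Z \<Otimes>\<^sub>M borel_on A) \<Otimes>\<^sub>M borel_on Z \<rightarrow>\<^sub>M prob_algebra (borel_on A)}"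

definition stationary_policy :: "'a::polish_space set \<Rightarrow> ('z \<Rightarrow> 'a) \<Rightarrow> ('z, 'a) policy" where
  "stationary_policy A f = (\<lambda>t h z. return (borel_on A) (f z))"

text \<open>Conditional law of the state-action pair at time \<open>t\<close> given the previous pairs, and the
  resulting Ionescu-Tulcea measure on infinite trajectories started at \<open>z\<close>.\<close>

definition step_law :: "'z::polish_space set \<Rightarrow> 'a::polish_space set \<Rightarrow> ('z \<Rightarrow> 'a \<Rightarrow> 'z measure) \<Rightarrow>
    ('z, 'a) policy \<Rightarrow> 'z \<Rightarrow> nat \<Rightarrow> (nat \<Rightarrow> 'z \<times> 'a) \<Rightarrow> ('z \<times> 'a) measure" where
  "step_law Z A p \<pi> z t h =
     (case t of 0 \<Rightarrow> return (borel_on Z) z | Suc s \<Rightarrow> p (fst (h s)) (snd (h s))) \<bind>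
       (\<lambda>y. \<pi> t h y \<bind> (\<lambda>a. return (borel_on Z \<Otimes>\<^sub>M borel_on A) (y, a)))"

definition trajectory_law :: "'z::polish_space set \<Rightarrow> 'a::polish_space set \<Rightarrow> ('z \<Rightarrow> 'a \<Rightarrow> 'z measure) \<Rightarrow>
    ('z, 'a) policy \<Rightarrow> 'z \<Rightarrow> (nat \<Rightarrow> 'z \<times> 'a) measure" where
  "trajectory_law Z A p \<pi> z =
     projective_family.lim UNIV
       (Ionescu_Tulcea.CI (step_law Z A p \<pi> z) (\<lambda>_. borel_on Z \<Otimes>\<^sub>M borel_on A))
       (\<lambda>_. borel_on Z \<Otimes>\<^sub>M borel_on A)"

text \<open>The Ionescu-Tulcea construction is applicable, so that \<open>trajectory_law\<close> is meaningful.\<close>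

lemma (in MDP) Ionescu_Tulcea_step_law:
  assumes pi: "\<pi> \<in> policies Z A" and z: "z \<in> Z"
  shows "Ionescu_Tulcea (step_law Z A p \<pi> z) (\<lambda>_. borel_on Z \<Otimes>\<^sub>M borel_on A)"
proof -
  let ?M = "\<lambda>_::nat. borel_on Z \<Otimes>\<^sub>M borel_on A"
  note kernel[measurable]
  have p[measurable]: "(\<lambda>x. \<pi> t (fst x) (snd x)) \<in>
     PiM {0..<t} ?M \<Otimes>\<^sub>M borel_on Z \<rightarrow>\<^sub>M prob_algebra (borel_on A)" for t
    using pi by (auto simp: policies_def case_prod_beta')
  have kp: "(\<lambda>h. case t of 0 \<Rightarrow> return (borel_on Z) z | Suc s \<Rightarrow> p (fst (h s)) (snd (h s)))
     \<in> PiM {0..<t} ?M \<rightarrow>\<^sub>M prob_algebra (borel_on Z)" for t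
  proof (cases t)
    case 0
    have "return (borel_on Z) z \<in> space (prob_algebra (borel_on Z))"
      using z by (auto simp: space_prob_algebra space_restrict_space intro!: prob_space_return)
    then show ?thesis by (auto simp: 0)
  next
    case (Suc s)
    have "(\<lambda>h. h s) \<in> PiM {0..<t} ?M \<rightarrow>\<^sub>M borel_on Z \<Otimes>\<^sub>M borel_on A"
      by (rule measurable_component_singleton) (simp add: Suc)
    from measurable_compose[OF this kernel] show ?thesis
      by (simp add: Suc case_prod_beta)
  qed
  have m: "step_law Z A p \<pi> z t \<in> PiM {0..<t} ?M \<rightarrow>\<^sub>M prob_algebra (borel_on Z \<Otimes>\<^sub>M borel_on A)" for t
    unfolding step_law_def
  proof (rule measurable_bind_prob_space2[OF kp])
    have "(\<lambda>x. \<pi> t (fst x) (snd x) \<bind> (\<lambda>a. return (borel_on Z \<Otimes>\<^sub>M borel_on A) (snd x, a)))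
        \<in> PiM {0..<t} ?M \<Otimes>\<^sub>M borel_on Z \<rightarrow>\<^sub>M prob_algebra (borel_on Z \<Otimes>\<^sub>M borel_on A)"
      by (rule measurable_bind_prob_space2[OF p]) measurable
    then show "(\<lambda>(h, y). \<pi> t h y \<bind> (\<lambda>a. return (borel_on Z \<Otimes>\<^sub>M borel_on A) (y, a)))
        \<in> PiM {0..<t} ?M \<Otimes>\<^sub>M borel_on Z \<rightarrow>\<^sub>M prob_algebra (borel_on Z \<Otimes>\<^sub>M borel_on A)"
      by (simp add: case_prod_beta')
  qed
  show ?thesis
    using m[THEN measurable_prob_algebraD] m[THEN measurable_space]
    by (intro Ionescu_Tulcea.intro) (auto simp: space_prob_algebra)
qed

lemma (in MDP) stationary_policy_in:
  assumes [measurable]: "f \<in> det_stationary Z A" shows "stationary_policy A f \<in> policies Z A"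
  using assms unfolding det_stationary_def stationary_policy_def policies_def by simp

definition avg_cost :: "'z::polish_space set \<Rightarrow> 'a::polish_space set \<Rightarrow> ('z \<Rightarrow> 'a \<Rightarrow> 'z measure) \<Rightarrow>
    ('z \<Rightarrow> 'a \<Rightarrow> real) \<Rightarrow> ('z, 'a) policy \<Rightarrow> 'z \<Rightarrow> ereal" where
  "avg_cost Z A p c \<pi> z = limsup (\<lambda>T. ereal (1 / real T *
     (\<integral>\<omega>. (\<Sum>t<T. c (fst (\<omega> t)) (snd (\<omega> t))) \<partial>trajectory_law Z A p \<pi> z)))"

definition avg_optimal :: "'z::polish_space set \<Rightarrow> 'a::polish_space set \<Rightarrow> ('z \<Rightarrow> 'a \<Rightarrow> 'z measure) \<Rightarrow>
    ('z \<Rightarrow> 'a \<Rightarrow> real) \<Rightarrow> ('z \<Rightarrow> 'a) \<Rightarrow> bool" where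
  "avg_optimal Z A p c f \<longleftrightarrow> f \<in> det_stationary Z A \<and>
     (\<forall>z\<in>Z. avg_cost Z A p c (stationary_policy A f) z = (INF \<pi>\<in>policies Z A. avg_cost Z A p c \<pi> z))"

section \<open>Markov chains on \<open>Z\<close>\<close>

primrec kernel_pow :: "'z::topological_space set \<Rightarrow> ('z \<Rightarrow> 'z measure) \<Rightarrow> nat \<Rightarrow> 'z \<Rightarrow> 'z measure" where
  "kernel_pow Z K 0 z = return (borel_on Z) z"
| "kernel_pow Z K (Suc t) z = kernel_pow Z K t z \<bind> K"

definition invariant_prob :: "'z::topological_space set \<Rightarrow> ('z \<Rightarrow> 'z measure) \<Rightarrow> 'z measure" where
  "invariant_prob Z K = (THE \<mu>. \<mu> \<in> space (prob_algebra (borel_on Z)) \<and> \<mu> \<bind> K = \<mu>)"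

text \<open>\<open>\<rho>\<^sub>f\<close>\<close>

definition ergodic_cost :: "'z::topological_space set \<Rightarrow> ('z \<Rightarrow> 'a \<Rightarrow> 'z measure) \<Rightarrow>
    ('z \<Rightarrow> 'a \<Rightarrow> real) \<Rightarrow> ('z \<Rightarrow> 'a) \<Rightarrow> real" where
  "ergodic_cost Z p c f = (\<integral>z. c z (f z) \<partial>invariant_prob Z (\<lambda>z. p z (f z)))"

section \<open>Norms and moduli of continuity\<close>

text \<open>Suprema are taken in \<open>real\<close>; they are only used where the sets are nonempty and bounded
  (probability measures, bounded costs, and \<open>r \<ge> 0\<close>).\<close>

definition tv_dist :: "'z measure \<Rightarrow> 'z measure \<Rightarrow> real" where
  "tv_dist \<mu> \<nu> = 2 * (SUP D\<in>sets \<mu>. \<bar>measure \<mu> D - measure \<nu> D\<bar>)"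

definition sup_norm :: "'z set \<Rightarrow> 'a set \<Rightarrow> ('z \<Rightarrow> 'a \<Rightarrow> real) \<Rightarrow> real" where
  "sup_norm Z A c = (SUP (z, a)\<in>Z \<times> A. \<bar>c z a\<bar>)"

definition modulus_cost :: "'z::metric_space set \<Rightarrow> 'a set \<Rightarrow> ('z \<Rightarrow> 'a \<Rightarrow> real) \<Rightarrow> real \<Rightarrow> real" where
  "modulus_cost Z A c r =
     (SUP (a, z, y)\<in>{(a, z, y). a \<in> A \<and> z \<in> Z \<and> y \<in> Z \<and> dist z y \<le> r}. \<bar>c z a - c y a\<bar>)"

definition modulus_kernel ::
    "'z::metric_space set \<Rightarrow> 'a set \<Rightarrow> ('z \<Rightarrow> 'a \<Rightarrow> 'z measure) \<Rightarrow> real \<Rightarrow> real" where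
  "modulus_kernel Z A p r =
     (SUP (a, z, y)\<in>{(a, z, y). a \<in> A \<and> z \<in> Z \<and> y \<in> Z \<and> dist z y \<le> r}. tv_dist (p z a) (p y a))"

definition tv_continuous :: "'z::topological_space set \<Rightarrow> 'a::topological_space set \<Rightarrow>
    ('z \<Rightarrow> 'a \<Rightarrow> 'z measure) \<Rightarrow> bool" where
  "tv_continuous Z A p \<longleftrightarrow> (\<forall>z\<in>Z. \<forall>a\<in>A.
     ((\<lambda>(y, b). tv_dist (p y b) (p z a)) \<longlongrightarrow> 0) (at (z, a) within Z \<times> A))"

section \<open>Finite-state models\<close>

text \<open>The grid points themselves serve as indices: \<open>cell Z Q y\<close> is \<open>\<S>\<^sub>n\<^sub>,\<^sub>i\<close> for \<open>y = z\<^sub>n\<^sub>,\<^sub>i\<close>, and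
  \<open>Q z\<close> plays the role of \<open>i\<^sub>n(z)\<close>. The measure \<open>\<nu>\<^sub>n\<^sub>,\<^sub>i\<close> is regarded as a measure on all of \<open>Z\<close>
  that is concentrated on the cell.\<close>

definition nearest_neighbour_map :: "'z::metric_space set \<Rightarrow> 'z set \<Rightarrow> ('z \<Rightarrow> 'z) \<Rightarrow> bool" where
  "nearest_neighbour_map Z Zn Q \<longleftrightarrow> Q \<in> borel_on Z \<rightarrow>\<^sub>M borel_on Zn \<and>
     (\<forall>z\<in>Z. dist z (Q z) = (MIN y\<in>Zn. dist z y))"

definition cell :: "'z set \<Rightarrow> ('z \<Rightarrow> 'z) \<Rightarrow> 'z \<Rightarrow> 'z set" where
  "cell Z Q y = {z\<in>Z. Q z = y}"

definition cell_measure :: "'z set \<Rightarrow> ('z \<Rightarrow> 'z) \<Rightarrow> 'z measure \<Rightarrow> 'z \<Rightarrow> 'z measure" where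
  "cell_measure Z Q \<nu> y = uniform_measure \<nu> (cell Z Q y)"

definition finite_cost :: "'z set \<Rightarrow> ('z \<Rightarrow> 'z) \<Rightarrow> 'z measure \<Rightarrow> ('z \<Rightarrow> 'a \<Rightarrow> real) \<Rightarrow> 'z \<Rightarrow> 'a \<Rightarrow> real" where
  "finite_cost Z Q \<nu> c y a = (\<integral>x. c x a \<partial>cell_measure Z Q \<nu> y)"

definition finite_kernel :: "'z set \<Rightarrow> 'z set \<Rightarrow> ('z \<Rightarrow> 'z) \<Rightarrow> 'z measure \<Rightarrow>
    ('z \<Rightarrow> 'a \<Rightarrow> 'z measure) \<Rightarrow> 'z \<Rightarrow> 'a \<Rightarrow> 'z measure" where
  "finite_kernel Z Zn Q \<nu> p y a = point_measure Zn
     (\<lambda>w. ennreal (\<integral>x. measure (p x a) (cell Z Q w) \<partial>cell_measure Z Q \<nu> y))"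

text \<open>The kernel \<open>q\<^sub>n\<close> on \<open>Z\<close>.\<close>

definition averaged_kernel :: "'z set \<Rightarrow> ('z \<Rightarrow> 'z) \<Rightarrow> 'z measure \<Rightarrow>
    ('z \<Rightarrow> 'a \<Rightarrow> 'z measure) \<Rightarrow> 'z \<Rightarrow> 'a \<Rightarrow> 'z measure" where
  "averaged_kernel Z Q \<nu> p z a = cell_measure Z Q \<nu> (Q z) \<bind> (\<lambda>x. p x a)"

end

theory Submission
  imports Defs
begin

text \<open>The finite chain lives on \<open>Zn\<close>, where its laws cannot be compared with
  those of \<open>p\<close> in total variation. The bridge is the model on all of \<open>Z\<close>
  with kernel \<open>q\<close> and cost \<open>b\<close>: it averages \<open>p\<close> and
  \<open>c\<close> over the cell of the current state, so it is close to the original model state by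
  state, and its image under \<open>Q\<close> is exactly the finite model.

  Origin of the constants, with M the sup norm of \<open>c\<close>: integrating a function with
  values in [-M, M] against two probability measures costs at most M times their distance. For one
  policy, leaving either invariant measure for its t-step law costs M * R * \<kappa>^t, exchanging
  the t-step laws costs M * t * \<omega>_p, and exchanging the costs \<open>c\<close> and
  \<open>b\<close> costs \<omega>_c. Two such comparisons give the factors 4, 2 and 2. The time t is
  a free parameter that balances mixing against accumulated kernel error. The contraction factor
  \<open>lam\<close> makes the invariant measures and the limits of average costs exist; the rate in
  the bound is the given \<kappa>.\<close>

text \<open>
  The minorization condition makes every chain \<open>p(\<cdot>|z,f(z))\<close>, \<open>q\<^sub>n(\<cdot>|z,f(z))\<close> and every chain of the
  finite model a contraction on oscillations, so each has a unique invariant probability measure and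
  the average cost of a stationary policy is its ergodic cost. For a fixed policy \<open>f\<close>, comparing
  \<open>\<mu>\<^sub>f\<close> and the invariant measure of \<open>q\<^sub>n\<close> through the \<open>t\<close>-step kernels shows that the costs of \<open>f\<close>
  under \<open>p\<close> and \<open>q\<^sub>n\<close> differ by at most half of the claimed bound. The policy \<open>f\<^sub>n\<^sup>* \<circ> Q\<^sub>n\<close> is optimal
  among the stationary policies for \<open>q\<^sub>n\<close>, and \<open>f\<^sup>*\<close> is optimal for \<open>p\<close>; using the comparison once for
  each of the two policies gives the theorem. The optimality of \<open>f\<^sub>n\<^sup>* \<circ> Q\<^sub>n\<close> against policies that are not
  constant on cells follows from an approximate average cost optimality equation, obtained by value
  iteration on the finite model.
\<close>

section \<open>Comparison of integrals\<close>

text \<open>For indicators this is the hypothesis; multiples, sums and monotone limits preserve it,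
  so induction over the construction of measurable functions suffices. It serves to compare
  \<open>\<eta>\<close> with a kernel row and two measures on a Hahn set.\<close>

lemma nn_integral_mono_sets:
  assumes sets: "sets N = sets M" and le: "\<And>B. B \<in> sets M \<Longrightarrow> emeasure N B \<le> emeasure M B"
    and f: "f \<in> borel_measurable M"
  shows "(\<integral>\<^sup>+x. f x \<partial>N) \<le> (\<integral>\<^sup>+x. f x \<partial>M)"
  using f
proof (induction rule: borel_measurable_induct)
  case (cong f g)
  have "space M = space N" using sets by (metis sets_eq_imp_space_eq)
  then show ?case
    using cong nn_integral_cong[of M f g] nn_integral_cong[of N f g] by auto
next
  case (set A)
  then show ?case using sets le by simp
next
  case (mult u c)
  then show ?case using sets by (simp add: nn_integral_cmult mult_left_mono measurable_cong_sets[OF sets refl])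
next
  case (add u v)
  then show ?case using sets by (simp add: nn_integral_add add_mono measurable_cong_sets[OF sets refl])
next
  case (seq U)
  have "U i \<in> borel_measurable N" for i using seq(1) by (simp add: measurable_cong_sets[OF sets refl])
  then show ?case
    using seq unfolding SUP_apply
    by (subst (1 2) nn_integral_monotone_convergence_SUP) (auto intro!: SUP_mono')
qed

text \<open>A bounded nonnegative function has a finite integral under the larger measure, so the
  inequality between extended integrals passes to the reals.\<close>

lemma integral_mono_sets:
  fixes f :: "'a \<Rightarrow> real"
  assumes sets: "sets N = sets M" and M: "finite_measure M"
    and le: "\<And>B. B \<in> sets M \<Longrightarrow> emeasure N B \<le> emeasure M B"
    and f: "f \<in> borel_measurable M" and bd: "\<And>x. x \<in> space M \<Longrightarrow> 0 \<le> f x" "\<And>x. x \<in> space M \<Longrightarrow> f x \<le> b"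
  shows "(\<integral>x. f x \<partial>N) \<le> (\<integral>x. f x \<partial>M)"
proof -
  interpret finite_measure M by fact
  have sp: "space N = space M" using sets by (rule sets_eq_imp_space_eq)
  have "integrable M f"
    using bd by (intro integrable_const_bound[where B=b] f) auto
  then have "(\<integral>\<^sup>+x. ennreal (f x) \<partial>M) < \<infinity>"
    using bd by (simp add: nn_integral_eq_integral)
  moreover have "(\<integral>\<^sup>+x. ennreal (f x) \<partial>N) \<le> (\<integral>\<^sup>+x. ennreal (f x) \<partial>M)"
    using f by (intro nn_integral_mono_sets sets le) auto
  moreover have "f \<in> borel_measurable N" using f by (simp add: measurable_cong_sets[OF sets refl])
  ultimately show ?thesis
    using f bd sp by (subst (1 2) integral_eq_nn_integral) (auto intro!: enn2real_mono)
qed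

lemma (in prob_space) integral_between:
  fixes f :: "'a \<Rightarrow> real"
  assumes f: "f \<in> borel_measurable M"
    and bd: "\<And>x. x \<in> space M \<Longrightarrow> l \<le> f x" "\<And>x. x \<in> space M \<Longrightarrow> f x \<le> u"
  shows "integrable M f" "l \<le> (\<integral>x. f x \<partial>M)" "(\<integral>x. f x \<partial>M) \<le> u"
proof -
  show i: "integrable M f"
    using bd by (intro integrable_const_bound[where B="max \<bar>l\<bar> \<bar>u\<bar>"] f AE_I2) (force simp: abs_le_iff)
  show "l \<le> (\<integral>x. f x \<partial>M)" "(\<integral>x. f x \<partial>M) \<le> u"
    using bd by (auto intro!: integral_ge_const integral_le_const i AE_I2)
qed

lemma (in prob_space) integral_abs_le:
  fixes f :: "'a \<Rightarrow> real"
  assumes "f \<in> borel_measurable M" and "\<And>x. x \<in> space M \<Longrightarrow> \<bar>f x\<bar> \<le> b"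
  shows "integrable M f" "\<bar>\<integral>x. f x \<partial>M\<bar> \<le> b"
  using integral_between[OF assms(1), of "-b" b] assms(2) by (auto simp: abs_le_iff minus_le_iff)

lemma in_prob_algebraD:
  assumes "\<mu> \<in> space (prob_algebra M)"
  shows "prob_space \<mu>" "sets \<mu> = sets M" "space \<mu> = space M"
  using assms by (auto simp: space_prob_algebra dest: sets_eq_imp_space_eq)

lemma integral_bind_prob:
  fixes f :: "'b \<Rightarrow> real"
  assumes \<mu>: "\<mu> \<in> space (prob_algebra M)" and K: "K \<in> M \<rightarrow>\<^sub>M prob_algebra N"
    and f: "f \<in> borel_measurable N" and bd: "\<And>x. x \<in> space N \<Longrightarrow> \<bar>f x\<bar> \<le> b"
  shows "(\<integral>x. f x \<partial>(\<mu> \<bind> K)) = (\<integral>x. (\<integral>y. f y \<partial>K x) \<partial>\<mu>)"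
proof (rule integral_bind[where K=N and B=b and B'=1])
  show "finite_measure \<mu>"
    using in_prob_algebraD(1)[OF \<mu>] by (simp add: prob_space_def)
  show "K \<in> \<mu> \<rightarrow>\<^sub>M subprob_algebra N"
    using measurable_prob_algebraD[OF K] by (simp add: measurable_cong_sets[OF in_prob_algebraD(2)[OF \<mu>] refl])
  show "AE x in \<mu>. emeasure (K x) (space (K x)) \<le> ennreal 1"
    using measurable_space[OF K] in_prob_algebraD(3)[OF \<mu>]
    by (intro AE_I2) (metis dual_order.refl ennreal_1 in_prob_algebraD(1) prob_space.emeasure_space_1)
qed (use f bd in auto)

lemma measurable_integral_kernel:
  fixes f :: "'b \<Rightarrow> real"
  assumes "K \<in> M \<rightarrow>\<^sub>M prob_algebra N" "f \<in> borel_measurable N"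
  shows "(\<lambda>x. \<integral>y. f y \<partial>K x) \<in> borel_measurable M"
  using measurable_compose[OF measurable_prob_algebraD[OF assms(1)]
      integral_measurable_subprob_algebra[OF assms(2)]] .

lemma measure_bind_prob:
  assumes \<mu>: "\<mu> \<in> space (prob_algebra M)" and K: "K \<in> M \<rightarrow>\<^sub>M prob_algebra N" and D: "D \<in> sets N"
  shows "measure (\<mu> \<bind> K) D = (\<integral>x. measure (K x) D \<partial>\<mu>)"
proof -
  interpret prob_space \<mu> using \<mu> by (rule in_prob_algebraD)
  have "K \<in> \<mu> \<rightarrow>\<^sub>M subprob_algebra N"
    using measurable_prob_algebraD[OF K] by (simp add: measurable_cong_sets[OF in_prob_algebraD(2)[OF \<mu>] refl])
  from measure_bind[OF this D] show ?thesis .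
qed

lemma bind_in_prob_algebra:
  "\<mu> \<in> space (prob_algebra M) \<Longrightarrow> K \<in> M \<rightarrow>\<^sub>M prob_algebra N \<Longrightarrow> \<mu> \<bind> K \<in> space (prob_algebra N)"
  by (simp add: space_prob_algebra[of N] prob_space_bind' sets_bind')

lemma integral_indicator_prob:
  assumes "\<mu> \<in> space (prob_algebra M)" "D \<in> sets M"
  shows "(\<integral>x. indicator D x \<partial>\<mu>) = measure \<mu> D"
  using sets.sets_into_space[OF assms(2)] in_prob_algebraD[OF assms(1)] by (simp add: Int_absorb2)

lemma prob_algebra_eqI:
  assumes "\<mu> \<in> space (prob_algebra M)" "\<nu> \<in> space (prob_algebra M)"
    and "\<And>D. D \<in> sets M \<Longrightarrow> measure \<mu> D = measure \<nu> D"
  shows "\<mu> = \<nu>"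
proof (rule measure_eqI)
  interpret \<mu>: prob_space \<mu> using assms(1) by (rule in_prob_algebraD)
  interpret \<nu>: prob_space \<nu> using assms(2) by (rule in_prob_algebraD)
  show "emeasure \<mu> D = emeasure \<nu> D" if "D \<in> sets \<mu>" for D
    using that assms in_prob_algebraD(2)[OF assms(1)]
    by (simp add: \<mu>.emeasure_eq_measure \<nu>.emeasure_eq_measure)
qed (use assms in \<open>simp add: space_prob_algebra\<close>)

section \<open>Total variation distance\<close>

context
  fixes \<mu> \<nu> :: "'a measure" and M :: "'a measure"
  assumes \<mu>: "\<mu> \<in> space (prob_algebra M)" and \<nu>: "\<nu> \<in> space (prob_algebra M)"
begin

interpretation \<mu>: prob_space \<mu> using \<mu> by (rule in_prob_algebraD)
interpretation \<nu>: prob_space \<nu> using \<nu> by (rule in_prob_algebraD)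

lemma abs_measure_diff_le_tv:
  assumes "D \<in> sets M"
  shows "\<bar>measure \<mu> D - measure \<nu> D\<bar> \<le> tv_dist \<mu> \<nu> / 2"
proof -
  have "\<bar>measure \<mu> D - measure \<nu> D\<bar> \<le> 1" for D
    using \<mu>.prob_le_1[of D] \<nu>.prob_le_1[of D] measure_nonneg[of \<mu> D] measure_nonneg[of \<nu> D] by linarith
  then have "\<bar>measure \<mu> D - measure \<nu> D\<bar> \<le> (SUP D\<in>sets \<mu>. \<bar>measure \<mu> D - measure \<nu> D\<bar>)"
    using assms in_prob_algebraD(2)[OF \<mu>] by (intro cSUP_upper bdd_aboveI2[where M=1]) auto
  then show ?thesis by (simp add: tv_dist_def)
qed

lemma tv_dist_leI:
  assumes "\<And>D. D \<in> sets M \<Longrightarrow> \<bar>measure \<mu> D - measure \<nu> D\<bar> \<le> b / 2"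
  shows "tv_dist \<mu> \<nu> \<le> b"
proof -
  have "(SUP D\<in>sets \<mu>. \<bar>measure \<mu> D - measure \<nu> D\<bar>) \<le> b / 2"
    using assms in_prob_algebraD(2)[OF \<mu>] by (intro cSUP_least) auto
  then show ?thesis by (simp add: tv_dist_def)
qed

lemma tv_dist_le_2: "tv_dist \<mu> \<nu> \<le> 2"
  using \<mu>.prob_le_1 \<nu>.prob_le_1 measure_nonneg[of \<mu>] measure_nonneg[of \<nu>]
  by (intro tv_dist_leI) (smt (verit) field_sum_of_halves)

text \<open>Take a Hahn set \<open>Y\<close> for \<mu> - \<nu>. Replacing f by \<open>u\<close> on
  \<open>Y\<close> and by \<open>l\<close> outside can only increase the difference, and what
  results is (u - l) * (\<mu> Y - \<nu> Y). The factor 1/2 appears because \<open>tv_dist\<close> is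
  twice the supremum over sets.\<close>

lemma integral_diff_le_tv:
  fixes f :: "'a \<Rightarrow> real"
  assumes f: "f \<in> borel_measurable M"
    and bd: "\<And>x. x \<in> space M \<Longrightarrow> l \<le> f x" "\<And>x. x \<in> space M \<Longrightarrow> f x \<le> u" and "l \<le> u"
  shows "(\<integral>x. f x \<partial>\<mu>) - (\<integral>x. f x \<partial>\<nu>) \<le> (u - l) / 2 * tv_dist \<mu> \<nu>"
proof -
  have sets: "sets \<mu> = sets M" "sets \<nu> = sets M" "space \<mu> = space M" "space \<nu> = space M"
    using \<mu> \<nu> by (simp_all add: in_prob_algebraD)
  have [measurable_cong]: "sets \<mu> = sets M" "sets \<nu> = sets M" by fact+
  note f[measurable]
  obtain Y where Y[measurable]: "Y \<in> sets M"
    and Y1: "\<And>X. X \<in> sets M \<Longrightarrow> X \<subseteq> Y \<Longrightarrow> emeasure \<nu> X \<le> emeasure \<mu> X"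
    and Y2: "\<And>X. X \<in> sets M \<Longrightarrow> X \<inter> Y = {} \<Longrightarrow> emeasure \<mu> X \<le> emeasure \<nu> X"
    using finite_unsigned_Hahn_decomposition[OF \<mu>.finite_measure_axioms \<nu>.finite_measure_axioms]
      sets by metis
  \<comment> \<open>An integral over a subset becomes an integral against the restricted measure, so
    that \<open>integral_mono_sets\<close> applies to the restrictions of \<mu> and \<nu>.\<close>
  have dens: "(\<integral>x. indicator S x * g x \<partial>N) = (\<integral>x. g x \<partial>density N (indicator S))"
    if "S \<in> sets M" "g \<in> borel_measurable M" "sets N = sets M" for S N and g :: "'a \<Rightarrow> real"
  proof -
    have "g \<in> borel_measurable N" "S \<in> sets N" using that by (simp_all add: measurable_cong_sets[OF that(3) refl])
    then show ?thesis
      using integral_density[of g N "indicator S"] by (simp add: ennreal_indicator)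
  qed
  have ed: "emeasure (density N (indicator S)) B = emeasure N (S \<inter> B)"
    if "sets N = sets M" "S \<in> sets M" "B \<in> sets M" for N S B
    using that by (simp add: emeasure_density flip: indicator_inter_arith)
  have fin: "finite_measure (density N (indicator S))" if "prob_space N" "sets N = sets M" "S \<in> sets M" for N S
  proof
    interpret N: prob_space N by fact
    show "emeasure (density N (indicator S)) (space (density N (indicator S))) \<noteq> \<infinity>"
      using ed[OF that(2,3) sets.top] sets_eq_imp_space_eq[OF that(2)] by simp
  qed
  have "(\<integral>x. indicator Y x * (u - f x) \<partial>\<nu>) \<le> (\<integral>x. indicator Y x * (u - f x) \<partial>\<mu>)"
    using bd sets \<mu>.prob_space_axioms
    by (simp add: dens) (intro integral_mono_sets[where b="u-l"] fin, auto simp: ed intro!: Y1)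
  moreover have "(\<integral>x. indicator (space M - Y) x * (f x - l) \<partial>\<mu>) \<le> (\<integral>x. indicator (space M - Y) x * (f x - l) \<partial>\<nu>)"
    using bd sets \<nu>.prob_space_axioms
    by (simp add: dens) (intro integral_mono_sets[where b="u-l"] fin, auto simp: ed intro!: Y2)
  \<comment> \<open>On \<open>Y\<close> write f as u - (u - f), outside as l + (f - l). Both
    corrections are nonnegative, and the two inequalities just shown give them the favourable sign
    in the difference.\<close>
  moreover have split: "(\<integral>x. f x \<partial>N) = u * measure N Y - (\<integral>x. indicator Y x * (u - f x) \<partial>N)
      + (\<integral>x. indicator (space M - Y) x * (f x - l) \<partial>N) + l * (1 - measure N Y)"
    if N: "N \<in> space (prob_algebra M)" for N
  proof -
    interpret N: prob_space N using N by (rule in_prob_algebraD)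
    have s[measurable_cong]: "sets N = sets M" and sp: "space N = space M" using N by (simp_all add: in_prob_algebraD)
    have i: "integrable N (\<lambda>x. indicator Y x * (u - f x))" "integrable N (\<lambda>x. indicator (space M - Y) x * (f x - l))"
      using bd sp \<open>l \<le> u\<close>
      by (auto intro!: N.integral_between(1)[where l=0 and u="u-l"] split: split_indicator)
    have Y': "Y \<in> sets N" "space M - Y \<in> sets N" using s by auto
    have "(\<integral>x. f x \<partial>N) = (\<integral>x. u * indicator Y x - indicator Y x * (u - f x)
        + indicator (space M - Y) x * (f x - l) + l * (1 - indicator Y x) \<partial>N)"
      using sp by (intro Bochner_Integration.integral_cong) (auto split: split_indicator simp: algebra_simps)
    also have "\<dots> = u * measure N Y - (\<integral>x. indicator Y x * (u - f x) \<partial>N)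
      + (\<integral>x. indicator (space M - Y) x * (f x - l) \<partial>N) + l * (1 - measure N Y)"
      using i Y' N.prob_space by (simp add: N.emeasure_eq_measure)
    finally show ?thesis .
  qed
  ultimately have "(\<integral>x. f x \<partial>\<mu>) - (\<integral>x. f x \<partial>\<nu>) \<le> (u - l) * (measure \<mu> Y - measure \<nu> Y)"
    using split[OF \<mu>] split[OF \<nu>] by (simp add: algebra_simps)
  also have "\<dots> \<le> (u - l) * (tv_dist \<mu> \<nu> / 2)"
    using abs_measure_diff_le_tv[OF Y] \<open>l \<le> u\<close> by (intro mult_left_mono) linarith+
  finally show ?thesis by simp
qed

lemma abs_integral_diff_le_tv:
  fixes f :: "'a \<Rightarrow> real"
  assumes f: "f \<in> borel_measurable M"
    and bd: "\<And>x. x \<in> space M \<Longrightarrow> l \<le> f x" "\<And>x. x \<in> space M \<Longrightarrow> f x \<le> u" and "l \<le> u"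
  shows "\<bar>(\<integral>x. f x \<partial>\<mu>) - (\<integral>x. f x \<partial>\<nu>)\<bar> \<le> (u - l) / 2 * tv_dist \<mu> \<nu>"
  using integral_diff_le_tv[OF assms] integral_diff_le_tv[of "\<lambda>x. - f x" "-u" "-l"] assms
  by (auto simp: abs_if)

end

section \<open>Markov chains satisfying a minorization condition\<close>

lemma space_borel_on [simp]: "space (borel_on X) = X"
  by (simp add: space_restrict_space)

lemma kernel_pow_measurable [measurable]:
  assumes "K \<in> borel_on Z \<rightarrow>\<^sub>M prob_algebra (borel_on Z)"
  shows "kernel_pow Z K t \<in> borel_on Z \<rightarrow>\<^sub>M prob_algebra (borel_on Z)"
proof (induction t)
  case 0
  have "kernel_pow Z K 0 = return (borel_on Z)" by (rule ext) simp
  then show ?case by simp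
next
  case (Suc t)
  have "kernel_pow Z K (Suc t) = (\<lambda>z. kernel_pow Z K t z \<bind> K)" by (rule ext) simp
  with measurable_bind_prob_space[OF Suc assms] show ?case by simp
qed

lemma tendsto_of_abs_diff_le:
  fixes a e :: "nat \<Rightarrow> real"
  assumes "\<And>t. \<bar>a t - L\<bar> \<le> e t" "e \<longlonglongrightarrow> 0"
  shows "a \<longlonglongrightarrow> L"
proof (rule LIM_zero_cancel, rule Lim_null_comparison[OF _ assms(2)])
  show "\<forall>\<^sub>F t in sequentially. norm (a t - L) \<le> e t" using assms(1) by simp
qed

text \<open>This is Doeblin's condition. The common part \<open>\<eta>\<close> is kept as an
  unnormalized measure independent of the state, so that one \<open>\<eta>\<close> can serve all
  policies of a model.\<close>

locale doeblin =
  fixes Z :: "'z::topological_space set" and K :: "'z \<Rightarrow> 'z measure" and \<eta> :: "'z measure" and lam :: real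
  assumes K [measurable]: "K \<in> borel_on Z \<rightarrow>\<^sub>M prob_algebra (borel_on Z)"
    and nonempty: "Z \<noteq> {}"
    and sets_\<eta>: "sets \<eta> = sets (borel_on Z)" and \<eta>_finite: "finite_measure \<eta>"
    and \<eta>_mass: "measure \<eta> Z = 1 - lam"
    and minor: "\<And>z B. z \<in> Z \<Longrightarrow> B \<in> sets (borel_on Z) \<Longrightarrow> measure \<eta> B \<le> measure (K z) B"
    and lam: "0 < lam" "lam < 1"
begin

lemma K_space: "z \<in> Z \<Longrightarrow> K z \<in> space (prob_algebra (borel_on Z))"
  using measurable_space[OF K] by simp

lemma pow_space: "z \<in> Z \<Longrightarrow> kernel_pow Z K t z \<in> space (prob_algebra (borel_on Z))"
  using measurable_space[OF kernel_pow_measurable[OF K]] by simp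

section \<open>Contraction of oscillations by the powers of the kernel\<close>

lemma integral_pow_Suc:
  fixes g :: "'z \<Rightarrow> real"
  assumes "z \<in> Z" "g \<in> borel_measurable (borel_on Z)" "\<And>x. x \<in> Z \<Longrightarrow> \<bar>g x\<bar> \<le> b"
  shows "(\<integral>x. g x \<partial>kernel_pow Z K (Suc t) z) = (\<integral>x. (\<integral>y. g y \<partial>K x) \<partial>kernel_pow Z K t z)"
  using integral_bind_prob[OF pow_space[OF assms(1)] K assms(2), of b] assms(3) by simp

text \<open>Subtracting the common part \<open>\<eta>\<close> leaves kernels of mass \<open>lam\<close>.\<close>

lemma integral_kernel_osc:
  fixes g :: "'z \<Rightarrow> real"
  assumes g: "g \<in> borel_measurable (borel_on Z)" and z: "z \<in> Z"
    and bd: "\<And>x. x \<in> Z \<Longrightarrow> l \<le> g x" "\<And>x. x \<in> Z \<Longrightarrow> g x \<le> l + b"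
  shows "l * lam \<le> (\<integral>x. g x \<partial>K z) - (\<integral>x. g x \<partial>\<eta>)"
    and "(\<integral>x. g x \<partial>K z) - (\<integral>x. g x \<partial>\<eta>) \<le> (l + b) * lam"
proof -
  interpret Kz: prob_space "K z" using K_space[OF z] by (rule in_prob_algebraD)
  interpret \<eta>: finite_measure \<eta> by (rule \<eta>_finite)
  have sp: "space \<eta> = Z" using sets_eq_imp_space_eq[OF sets_\<eta>] by simp
  have sK: "sets (K z) = sets (borel_on Z)" "space (K z) = Z"
    using in_prob_algebraD[OF K_space[OF z]] by auto
  have gm: "g \<in> borel_measurable (K z)" "g \<in> borel_measurable \<eta>"
    using g by (simp_all add: measurable_cong_sets[OF sK(1) refl] measurable_cong_sets[OF sets_\<eta> refl])
  have i: "integrable (K z) g" "integrable \<eta> g"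
    using bd sK sp gm
    by (auto intro!: Kz.integrable_const_bound[where B="\<bar>l\<bar> + \<bar>l + b\<bar>"] \<eta>.integrable_const_bound[where B="\<bar>l\<bar> + \<bar>l + b\<bar>"] AE_I2)
       (smt (verit) bd)+
  have le: "emeasure \<eta> B \<le> emeasure (K z) B" if "B \<in> sets (K z)" for B
    using minor[OF z, of B] that sK by (simp add: \<eta>.emeasure_eq_measure Kz.emeasure_eq_measure)
  have sets': "sets \<eta> = sets (K z)" using sK sets_\<eta> by simp
  \<comment> \<open>Domination of \<open>\<eta>\<close> by \<open>K z\<close> is applied to the
    nonnegative functions g - l and l + b - g, one for each bound. The constants have weight 1 under
    \<open>K z\<close> and 1 - lam under \<open>\<eta>\<close>, which leaves the factor
    \<open>lam\<close>.\<close>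
  have "(\<integral>x. g x - l \<partial>\<eta>) \<le> (\<integral>x. g x - l \<partial>K z)"
    using bd(1)[unfolded sK(2)[symmetric]] bd(2)[unfolded sK(2)[symmetric]] gm(1)
    by (intro integral_mono_sets[OF sets' Kz.finite_measure_axioms le, where b=b]) (auto simp: algebra_simps)
  moreover have "(\<integral>x. l + b - g x \<partial>\<eta>) \<le> (\<integral>x. l + b - g x \<partial>K z)"
    using bd(1)[unfolded sK(2)[symmetric]] bd(2)[unfolded sK(2)[symmetric]] gm(1)
    by (intro integral_mono_sets[OF sets' Kz.finite_measure_axioms le, where b=b]) (auto simp: algebra_simps)
  ultimately show "l * lam \<le> (\<integral>x. g x \<partial>K z) - (\<integral>x. g x \<partial>\<eta>)"
    "(\<integral>x. g x \<partial>K z) - (\<integral>x. g x \<partial>\<eta>) \<le> (l + b) * lam"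
    using i sp Kz.prob_space \<eta>_mass by (simp_all add: algebra_simps)
qed

text \<open>By \<open>integral_kernel_osc\<close>, one application of the kernel maps a function
  with values in an interval of length b to one with values in an interval of length lam * b. The
  new interval starts at the integral of g over \<open>\<eta>\<close> plus l * lam, so the induction
  must leave g, l and b arbitrary.\<close>

lemma integral_pow_osc:
  fixes g :: "'z \<Rightarrow> real"
  assumes "g \<in> borel_measurable (borel_on Z)"
    and "\<And>x. x \<in> Z \<Longrightarrow> l \<le> g x" "\<And>x. x \<in> Z \<Longrightarrow> g x \<le> l + b" and "x \<in> Z" "y \<in> Z"
  shows "\<bar>(\<integral>x. g x \<partial>kernel_pow Z K t x) - (\<integral>x. g x \<partial>kernel_pow Z K t y)\<bar> \<le> lam ^ t * b"
  using assms
proof (induction t arbitrary: g l b)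
  case 0
  have "\<bar>g x - g y\<bar> \<le> b"
    using 0(2)[of x] 0(3)[of x] 0(2)[of y] 0(3)[of y] \<open>x \<in> Z\<close> \<open>y \<in> Z\<close> by auto
  with 0 show ?case by (simp add: integral_return)
next
  case (Suc t)
  let ?g = "\<lambda>x. \<integral>y. g y \<partial>K x"
  have gb: "\<bar>g x\<bar> \<le> \<bar>l\<bar> + \<bar>l + b\<bar>" if "x \<in> Z" for x
    using Suc.prems(2,3)[OF that] by auto
  have "\<bar>(\<integral>x. ?g x \<partial>kernel_pow Z K t x) - (\<integral>x. ?g x \<partial>kernel_pow Z K t y)\<bar> \<le> lam ^ t * (b * lam)"
    using integral_kernel_osc[OF Suc.prems(1) _ Suc.prems(2,3)] Suc.prems(4,5)
    by (intro Suc.IH[where l="(\<integral>x. g x \<partial>\<eta>) + l * lam"] measurable_integral_kernel[OF K Suc.prems(1)])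
       (auto simp: algebra_simps)
  then show ?case
    using integral_pow_Suc[OF _ Suc.prems(1) gb] Suc.prems(4,5) by (simp add: mult_ac)
qed

text \<open>The Chapman-Kolmogorov equation. Since \<open>kernel_pow\<close> appends the last step,
  the induction on t replaces g by its integral under \<open>K\<close>.\<close>

lemma integral_pow_add:
  fixes g :: "'z \<Rightarrow> real"
  assumes "z \<in> Z" "g \<in> borel_measurable (borel_on Z)" "\<And>x. x \<in> Z \<Longrightarrow> \<bar>g x\<bar> \<le> b"
  shows "(\<integral>x. g x \<partial>kernel_pow Z K (s + t) z) = (\<integral>x. (\<integral>y. g y \<partial>kernel_pow Z K t x) \<partial>kernel_pow Z K s z)"
  using assms(2,3)
proof (induction t arbitrary: g)
  case 0
  then show ?case
    using in_prob_algebraD(3)[OF pow_space[OF assms(1), of s]]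
    by (intro Bochner_Integration.integral_cong) (simp_all add: integral_return)
next
  case (Suc t)
  have bd: "\<bar>\<integral>y. g y \<partial>K x\<bar> \<le> b" if "x \<in> Z" for x
  proof (intro prob_space.integral_abs_le(2) in_prob_algebraD(1)[OF K_space[OF that]])
    show "g \<in> borel_measurable (K x)"
      using Suc.prems(1) by (simp add: measurable_cong_sets[OF in_prob_algebraD(2)[OF K_space[OF that]] refl])
  qed (use Suc.prems(2) in_prob_algebraD(3)[OF K_space[OF that]] in auto)
  have "(\<integral>x. g x \<partial>kernel_pow Z K (s + Suc t) z) = (\<integral>x. (\<integral>y. g y \<partial>K x) \<partial>kernel_pow Z K (s + t) z)"
    using integral_pow_Suc[OF assms(1) Suc.prems] by simp
  also have "\<dots> = (\<integral>x. (\<integral>y. (\<integral>v. g v \<partial>K y) \<partial>kernel_pow Z K t x) \<partial>kernel_pow Z K s z)"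
    by (intro Suc.IH measurable_integral_kernel[OF K] Suc.prems bd)
  also have "\<dots> = (\<integral>x. (\<integral>y. g y \<partial>kernel_pow Z K (Suc t) x) \<partial>kernel_pow Z K s z)"
    using in_prob_algebraD(3)[OF pow_space[OF assms(1), of s]]
    by (intro Bochner_Integration.integral_cong[OF refl] integral_pow_Suc[symmetric, where b=b] Suc.prems) auto
  finally show ?case .
qed

text \<open>An average of the values \<open>\<integral> g dK\<^sup>t(x)\<close> is within their oscillation of each of them.\<close>

lemma integral_pow_mean:
  fixes g :: "'z \<Rightarrow> real"
  assumes g: "g \<in> borel_measurable (borel_on Z)"
    and bd: "\<And>x. x \<in> Z \<Longrightarrow> l \<le> g x" "\<And>x. x \<in> Z \<Longrightarrow> g x \<le> l + b" and z: "z \<in> Z"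
    and \<mu>: "\<mu> \<in> space (prob_algebra (borel_on Z))"
  shows "\<bar>(\<integral>x. (\<integral>y. g y \<partial>kernel_pow Z K t x) \<partial>\<mu>) - (\<integral>x. g x \<partial>kernel_pow Z K t z)\<bar> \<le> lam ^ t * b"
proof -
  interpret prob_space \<mu> using \<mu> by (rule in_prob_algebraD)
  let ?G = "\<lambda>x. \<integral>y. g y \<partial>kernel_pow Z K t x"
  have m: "?G \<in> borel_measurable \<mu>"
    using measurable_integral_kernel[OF kernel_pow_measurable[OF K] g]
    by (simp add: measurable_cong_sets[OF in_prob_algebraD(2)[OF \<mu>] refl])
  have "\<bar>?G x - ?G z\<bar> \<le> lam ^ t * b" if "x \<in> space \<mu>" for x
    using that in_prob_algebraD(3)[OF \<mu>] z by (intro integral_pow_osc[OF g bd]) auto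
  then have "?G z - lam ^ t * b \<le> ?G x" "?G x \<le> ?G z + lam ^ t * b" if "x \<in> space \<mu>" for x
    using that by (force simp: abs_le_iff algebra_simps)+
  from integral_between(2,3)[OF m this]
  have "?G z - lam ^ t * b \<le> (\<integral>x. ?G x \<partial>\<mu>)" "(\<integral>x. ?G x \<partial>\<mu>) \<le> ?G z + lam ^ t * b"
    by auto
  then show ?thesis by (simp add: abs_le_iff)
qed

section \<open>Invariant probability measures: convergence, uniqueness, existence\<close>

lemma invariant_integral_pow:
  fixes g :: "'z \<Rightarrow> real"
  assumes \<mu>: "\<mu> \<in> space (prob_algebra (borel_on Z))" "\<mu> \<bind> K = \<mu>"
    and "g \<in> borel_measurable (borel_on Z)" "\<And>x. x \<in> Z \<Longrightarrow> \<bar>g x\<bar> \<le> b"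
  shows "(\<integral>x. (\<integral>y. g y \<partial>kernel_pow Z K t x) \<partial>\<mu>) = (\<integral>x. g x \<partial>\<mu>)"
  using assms(3,4)
proof (induction t arbitrary: g)
  case 0
  then show ?case
    using in_prob_algebraD(3)[OF \<mu>(1)]
    by (intro Bochner_Integration.integral_cong) (simp_all add: integral_return)
next
  case (Suc t)
  have bd: "\<bar>\<integral>y. g y \<partial>K x\<bar> \<le> b" if "x \<in> Z" for x
  proof (intro prob_space.integral_abs_le(2) in_prob_algebraD(1)[OF K_space[OF that]])
    show "g \<in> borel_measurable (K x)"
      using Suc.prems(1) by (simp add: measurable_cong_sets[OF in_prob_algebraD(2)[OF K_space[OF that]] refl])
  qed (use Suc.prems(2) in_prob_algebraD(3)[OF K_space[OF that]] in auto)
  have "(\<integral>x. (\<integral>y. g y \<partial>kernel_pow Z K (Suc t) x) \<partial>\<mu>)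
      = (\<integral>x. (\<integral>y. (\<integral>v. g v \<partial>K y) \<partial>kernel_pow Z K t x) \<partial>\<mu>)"
    using in_prob_algebraD(3)[OF \<mu>(1)]
    by (intro Bochner_Integration.integral_cong[OF refl] integral_pow_Suc[where b=b] Suc.prems) auto
  also have "\<dots> = (\<integral>x. (\<integral>v. g v \<partial>K x) \<partial>\<mu>)"
    by (intro Suc.IH measurable_integral_kernel[OF K] Suc.prems bd)
  also have "\<dots> = (\<integral>x. g x \<partial>(\<mu> \<bind> K))"
    using Suc.prems by (intro integral_bind_prob[OF \<mu>(1) K, symmetric]) auto
  finally show ?case by (simp add: \<mu>(2))
qed

text \<open>In \<open>integral_pow_mean\<close> the outer average over \<mu> collapses, by
  invariance, to the integral of g itself.\<close>

lemma pow_converges_to_invariant: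
  fixes g :: "'z \<Rightarrow> real"
  assumes \<mu>: "\<mu> \<in> space (prob_algebra (borel_on Z))" "\<mu> \<bind> K = \<mu>"
    and g: "g \<in> borel_measurable (borel_on Z)"
    and bd: "\<And>x. x \<in> Z \<Longrightarrow> l \<le> g x" "\<And>x. x \<in> Z \<Longrightarrow> g x \<le> l + b" and z: "z \<in> Z"
  shows "\<bar>(\<integral>x. g x \<partial>\<mu>) - (\<integral>x. g x \<partial>kernel_pow Z K t z)\<bar> \<le> lam ^ t * b"
proof -
  have gb: "\<bar>g x\<bar> \<le> \<bar>l\<bar> + \<bar>l + b\<bar>" if "x \<in> Z" for x
    using bd[OF that] by auto
  show ?thesis
    using integral_pow_mean[OF g bd z \<mu>(1)] invariant_integral_pow[OF \<mu> g gb] by simp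
qed

lemma lam_pow_tendsto: "(\<lambda>t. lam ^ t) \<longlonglongrightarrow> 0"
  using lam by (intro LIMSEQ_power_zero) auto

text \<open>From one fixed starting state, the probability of \<open>D\<close> after t steps
  converges to the mass of \<open>D\<close> under every invariant measure, and limits are
  unique.\<close>

lemma invariant_unique:
  assumes "\<mu> \<in> space (prob_algebra (borel_on Z))" "\<mu> \<bind> K = \<mu>"
    and "\<nu> \<in> space (prob_algebra (borel_on Z))" "\<nu> \<bind> K = \<nu>"
  shows "\<mu> = \<nu>"
proof (rule prob_algebra_eqI[OF assms(1,3)])
  fix D assume D: "D \<in> sets (borel_on Z)"
  obtain z where z: "z \<in> Z" using nonempty by auto
  define a where "a t = (\<integral>x. indicator D x \<partial>kernel_pow Z K t z :: real)" for t
  have lim: "a \<longlonglongrightarrow> measure \<mu> D"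
    if \<mu>: "\<mu> \<in> space (prob_algebra (borel_on Z))" "\<mu> \<bind> K = \<mu>" for \<mu>
  proof -
    have "\<bar>(\<integral>x. indicator D x \<partial>\<mu>) - a t\<bar> \<le> lam ^ t * 1" for t
      unfolding a_def using D by (intro pow_converges_to_invariant[OF \<mu> _ _ _ z, where l=0]) auto
    then have "\<bar>a t - measure \<mu> D\<bar> \<le> lam ^ t" for t
      unfolding integral_indicator_prob[OF \<mu>(1) D] by (simp add: abs_minus_commute)
    then show ?thesis
      using lam_pow_tendsto by (rule tendsto_of_abs_diff_le)
  qed
  show "measure \<mu> D = measure \<nu> D"
    using LIMSEQ_unique[OF lim[OF assms(1,2)] lim[OF assms(3,4)]] .
qed

text \<open>The rows \<open>K\<^sup>t(z)\<close> form a Cauchy sequence in total variation; the setwise limit is a measure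
  because the convergence is uniform.\<close>

lemma invariant_exists: "\<exists>\<mu>. \<mu> \<in> space (prob_algebra (borel_on Z)) \<and> \<mu> \<bind> K = \<mu>"
proof -
  obtain z where z: "z \<in> Z" using nonempty by auto
  let ?P = "\<lambda>t. kernel_pow Z K t z"
  note P = pow_space[OF z]
  have Psp: "prob_space (?P t)" "sets (?P t) = sets (borel_on Z)" "space (?P t) = Z" for t
    using in_prob_algebraD[OF P[of t]] by auto
  \<comment> \<open>The law after s + t steps averages the t-step rows over the law after s steps,
    so it is within \<open>lam ^ t\<close> of any one row. The bound does not depend on
    \<open>D\<close> or s.\<close>
  have diff: "\<bar>measure (?P (s + t)) D - measure (?P t) D\<bar> \<le> lam ^ t" if D: "D \<in> sets (borel_on Z)" for s t D
  proof -
    have "(\<integral>x. indicator D x \<partial>?P (s + t)) = (\<integral>x. (\<integral>y. indicator D y \<partial>kernel_pow Z K t x) \<partial>?P s :: real)"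
      using D by (intro integral_pow_add[OF z, where b=1]) auto
    moreover have "\<bar>(\<integral>x. (\<integral>y. indicator D y \<partial>kernel_pow Z K t x) \<partial>?P s) - (\<integral>x. indicator D x \<partial>?P t)\<bar> \<le> lam ^ t * 1"
      using D by (intro integral_pow_mean[OF _ _ _ z P, where l=0]) auto
    ultimately show ?thesis
      unfolding integral_indicator_prob[OF P D] by simp
  qed
  have "Cauchy (\<lambda>t. measure (?P t) D)" if D: "D \<in> sets (borel_on Z)" for D
  proof (rule metric_CauchyI)
    fix e :: real assume "0 < e"
    then obtain N where N: "lam ^ N < e / 2"
      using LIMSEQ_D[OF lam_pow_tendsto, of "e/2"] lam by auto
    show "\<exists>M. \<forall>m\<ge>M. \<forall>n\<ge>M. dist (measure (?P m) D) (measure (?P n) D) < e"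
    proof (intro exI[of _ N] allI impI)
      fix m n assume "m \<ge> N" "n \<ge> N"
      then show "dist (measure (?P m) D) (measure (?P n) D) < e"
        using diff[OF D, of "m - N" N] diff[OF D, of "n - N" N] N by (simp add: dist_real_def)
    qed
  qed
  then have lim: "(\<lambda>t. measure (?P t) D) \<longlonglongrightarrow> lim (\<lambda>t. measure (?P t) D)" if "D \<in> sets (borel_on Z)" for D
    using that by (metis Cauchy_convergent convergent_LIMSEQ_iff)
  define L where "L D = lim (\<lambda>t. measure (?P t) D)" for D
  have L: "(\<lambda>t. measure (?P t) D) \<longlonglongrightarrow> L D" if "D \<in> sets (borel_on Z)" for D
    using lim[OF that] by (simp add: L_def)
  have L0: "0 \<le> L D" if "D \<in> sets (borel_on Z)" for D
    using L[OF that] by (rule LIMSEQ_le_const) auto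
  \<comment> \<open>Letting s tend to infinity in \<open>diff\<close> keeps the bound uniform in
    \<open>D\<close>.\<close>
  have close: "\<bar>L D - measure (?P t) D\<bar> \<le> lam ^ t" if D: "D \<in> sets (borel_on Z)" for D t
  proof (rule LIMSEQ_le_const2)
    show "(\<lambda>s. \<bar>measure (?P (s + t)) D - measure (?P t) D\<bar>) \<longlonglongrightarrow> \<bar>L D - measure (?P t) D\<bar>"
      by (intro tendsto_intros LIMSEQ_ignore_initial_segment L D)
  qed (use diff[OF D] in auto)
  define \<mu> where "\<mu> = measure_of Z (sets (borel_on Z)) (\<lambda>D. ennreal (L D))"
  have LZ: "L Z = 1"
  proof (rule LIMSEQ_unique[OF L])
    show "(\<lambda>t. measure (?P t) Z) \<longlonglongrightarrow> 1"
      using prob_space.prob_space[OF Psp(1)] Psp(3) by simp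
  qed (use sets.top[of "borel_on Z"] in simp)
  have add: "additive (sets (borel_on Z)) (\<lambda>D. ennreal (L D))"
    unfolding additive_def
  proof (intro ballI impI)
    fix B D assume BD: "B \<in> sets (borel_on Z)" "D \<in> sets (borel_on Z)" "B \<inter> D = {}"
    have "(\<lambda>t. measure (?P t) (B \<union> D)) = (\<lambda>t. measure (?P t) B + measure (?P t) D)"
      using BD Psp by (auto intro!: finite_measure.finite_measure_Union prob_space.finite_measure)
    with L[of "B \<union> D"] tendsto_add[OF L L, OF BD(1,2)] have "L (B \<union> D) = L B + L D"
      using BD by (auto intro: LIMSEQ_unique)
    then show "ennreal (L (B \<union> D)) = ennreal (L B) + ennreal (L D)"
      using BD L0 by simp
  qed
  have pos: "positive (sets (borel_on Z)) (\<lambda>D. ennreal (L D))"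
    using LIMSEQ_unique[OF L[of "{}"], of 0] by (auto simp: positive_def)
  \<comment> \<open>Continuity at the empty set is enough. Uniformity lets one \<open>N\<close>
    bring \<open>L\<close> within e/2 of the measure \<open>?P N\<close> on all sets at once; the
    continuity of that single measure does the rest.\<close>
  have "countably_additive (sets (borel_on Z)) (\<lambda>D. ennreal (L D))"
  proof (rule ring_of_sets.empty_continuous_imp_countably_additive[OF _ pos add])
    show "ring_of_sets Z (sets (borel_on Z))"
      using sets.ring_of_sets_axioms[of "borel_on Z"] by simp
    fix D :: "nat \<Rightarrow> 'z set"
    assume D: "range D \<subseteq> sets (borel_on Z)" "decseq D" "(\<Inter>i. D i) = {}"
    have "(\<lambda>i. L (D i)) \<longlonglongrightarrow> 0"
    proof (rule LIMSEQ_I)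
      fix e :: real assume "0 < e"
      then obtain N where N: "lam ^ N < e / 2"
        using LIMSEQ_D[OF lam_pow_tendsto, of "e/2"] lam by auto
      have "(\<lambda>i. measure (?P N) (D i)) \<longlonglongrightarrow> measure (?P N) (\<Inter>i. D i)"
        using D Psp by (intro finite_measure.finite_Lim_measure_decseq prob_space.finite_measure) auto
      then obtain m where m: "\<And>i. i \<ge> m \<Longrightarrow> measure (?P N) (D i) < e / 2"
        using LIMSEQ_D[of "\<lambda>i. measure (?P N) (D i)" 0 "e/2"] D(3) \<open>0 < e\<close> by auto
      show "\<exists>no. \<forall>n\<ge>no. norm (L (D n) - 0) < e"
      proof (intro exI[of _ m] allI impI)
        fix i assume "i \<ge> m"
        then show "norm (L (D i) - 0) < e"
          using m[of i] close[of "D i" N] N L0[of "D i"] D(1) by (auto simp: abs_le_iff)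
      qed
    qed
    then show "(\<lambda>i. ennreal (L (D i))) \<longlonglongrightarrow> 0"
      using tendsto_ennrealI by fastforce
  qed simp
  then have em: "emeasure \<mu> D = ennreal (L D)" if "D \<in> sets (borel_on Z)" for D
    using that pos unfolding \<mu>_def
    by (intro emeasure_measure_of_sigma) (auto simp: sets.sigma_algebra_axioms[of "borel_on Z", simplified])
  have sets_\<mu>: "sets \<mu> = sets (borel_on Z)" and space_\<mu>: "space \<mu> = Z"
    unfolding \<mu>_def using sets.space_closed[of "borel_on Z"]
    by (simp_all add: sets.sigma_sets_eq[of "borel_on Z", simplified])
  have meas: "measure \<mu> D = L D" if "D \<in> sets (borel_on Z)" for D
    using em[OF that] L0[OF that] by (simp add: measure_def)
  have "prob_space \<mu>"
    using em[of Z] sets.top[of "borel_on Z"] LZ by (intro prob_spaceI) (simp add: space_\<mu>)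
  with sets_\<mu> have \<mu>: "\<mu> \<in> space (prob_algebra (borel_on Z))"
    by (simp add: space_prob_algebra)
  \<comment> \<open>The integral of the function K(.)(D) over the t-step law is the mass of
    \<open>D\<close> after t + 1 steps, so it tends to the mass under \<mu>. By convergence in total
    variation it also tends to the integral over \<mu>.\<close>
  have "\<mu> \<bind> K = \<mu>"
  proof (rule prob_algebra_eqI[OF bind_in_prob_algebra[OF \<mu> K] \<mu>])
    fix D assume D: "D \<in> sets (borel_on Z)"
    let ?g = "\<lambda>x. measure (K x) D"
    have gm: "?g \<in> borel_measurable (borel_on Z)"
      by (rule measurable_compose[OF K measurable_measure_prob_algebra[OF D]])
    have g1: "?g x \<le> 1" if "x \<in> Z" for x
      using in_prob_algebraD(1)[OF K_space[OF that]] by (rule prob_space.prob_le_1)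
    have "\<bar>(\<integral>x. ?g x \<partial>?P t) - (\<integral>x. ?g x \<partial>\<mu>)\<bar> \<le> lam ^ t" for t
    proof -
      have "\<bar>(\<integral>x. ?g x \<partial>?P t) - (\<integral>x. ?g x \<partial>\<mu>)\<bar> \<le> (1 - 0) / 2 * tv_dist (?P t) \<mu>"
        using gm g1 by (intro abs_integral_diff_le_tv[OF P \<mu>]) auto
      moreover have "tv_dist (?P t) \<mu> \<le> 2 * lam ^ t"
        using close by (intro tv_dist_leI[OF P \<mu>]) (simp add: meas abs_minus_commute)
      ultimately show ?thesis by simp
    qed
    then have "(\<lambda>t. \<integral>x. ?g x \<partial>?P t) \<longlonglongrightarrow> (\<integral>x. ?g x \<partial>\<mu>)"
      using lam_pow_tendsto by (rule tendsto_of_abs_diff_le)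
    moreover have "(\<integral>x. ?g x \<partial>?P t) = measure (?P (Suc t)) D" for t
      using measure_bind_prob[OF P K D] by simp
    moreover have "(\<lambda>t. measure (?P (Suc t)) D) \<longlonglongrightarrow> measure \<mu> D"
      using LIMSEQ_Suc[OF L[OF D]] D by (simp add: meas)
    ultimately have "(\<integral>x. ?g x \<partial>\<mu>) = measure \<mu> D"
      by (simp add: LIMSEQ_unique)
    then show "measure (\<mu> \<bind> K) D = measure \<mu> D"
      by (simp add: measure_bind_prob[OF \<mu> K D])
  qed
  with \<mu> show ?thesis by blast
qed

lemma invariant_prob:
  shows invariant_prob_space: "invariant_prob Z K \<in> space (prob_algebra (borel_on Z))"
    and invariant_prob_bind: "invariant_prob Z K \<bind> K = invariant_prob Z K"
proof -
  have "\<exists>!\<mu>. \<mu> \<in> space (prob_algebra (borel_on Z)) \<and> \<mu> \<bind> K = \<mu>"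
    using invariant_exists invariant_unique by blast
  from theI'[OF this] show "invariant_prob Z K \<in> space (prob_algebra (borel_on Z))"
    "invariant_prob Z K \<bind> K = invariant_prob Z K"
    unfolding invariant_prob_def by auto
qed

lemma invariant_prob_eqI:
  "\<mu> \<in> space (prob_algebra (borel_on Z)) \<Longrightarrow> \<mu> \<bind> K = \<mu> \<Longrightarrow> invariant_prob Z K = \<mu>"
  using invariant_unique invariant_prob by blast

end

section \<open>Average cost of stationary policies\<close>

context MDP
begin

lemma policy_kernel:
  assumes "f \<in> det_stationary Z A"
  shows "(\<lambda>x. p x (f x)) \<in> borel_on Z \<rightarrow>\<^sub>M prob_algebra (borel_on Z)"
proof -
  have "(\<lambda>x. (x, f x)) \<in> borel_on Z \<rightarrow>\<^sub>M borel_on Z \<Otimes>\<^sub>M borel_on A"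
    using assms unfolding det_stationary_def by measurable
  from measurable_compose[OF this kernel] show ?thesis by simp
qed

lemma policy_cost:
  assumes "f \<in> det_stationary Z A"
  shows "(\<lambda>x. c x (f x)) \<in> borel_measurable (borel_on Z)"
proof -
  have "(\<lambda>x. (x, f x)) \<in> borel_on Z \<rightarrow>\<^sub>M borel_on Z \<Otimes>\<^sub>M borel_on A"
    using assms unfolding det_stationary_def by measurable
  from measurable_compose[OF this cost] show ?thesis by simp
qed

lemma det_stationary_in:
  "f \<in> det_stationary Z A \<Longrightarrow> x \<in> Z \<Longrightarrow> f x \<in> A"
  using measurable_space[of f "borel_on Z" "borel_on A" x] by (simp add: det_stationary_def)

context
  fixes f z
  assumes f: "f \<in> det_stationary Z A" and z: "z \<in> Z"
begin

section \<open>One-dimensional marginals of the trajectory law under a stationary policy\<close>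

private abbreviation "MM \<equiv> borel_on Z \<Otimes>\<^sub>M borel_on A"
private abbreviation "F \<equiv> (\<lambda>y. (y, f y))"

private lemma F [measurable]: "F \<in> borel_on Z \<rightarrow>\<^sub>M MM"
  using f unfolding det_stationary_def by measurable

interpretation IT: Ionescu_Tulcea "step_law Z A p (stationary_policy A f) z" "\<lambda>_. MM"
  using Ionescu_Tulcea_step_law[OF stationary_policy_in[OF f] z] .

text \<open>The action is a function of the state, so the law of the pair is the image of the law of
  the state under the graph map \<open>F\<close>.\<close>

private lemma step_law_distr:
  assumes N: "N \<in> space (prob_algebra (borel_on Z))"
  shows "N \<bind> (\<lambda>y. stationary_policy A f t h y \<bind> (\<lambda>a. return MM (y, a))) = distr N MM F"
proof -
  have "N \<bind> (\<lambda>y. stationary_policy A f t h y \<bind> (\<lambda>a. return MM (y, a))) = N \<bind> (\<lambda>y. return MM (y, f y))"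
  proof (rule bind_cong[OF refl])
    fix y assume "y \<in> space N"
    then have y: "y \<in> Z" using in_prob_algebraD(3)[OF N] by simp
    have "(\<lambda>a. return MM (y, a)) \<in> borel_on A \<rightarrow>\<^sub>M subprob_algebra MM"
      using y by (intro measurable_compose[OF _ return_measurable] measurable_Pair1') simp
    then show "stationary_policy A f t h y \<bind> (\<lambda>a. return MM (y, a)) = return MM (y, f y)"
      unfolding stationary_policy_def by (rule bind_return) (simp add: det_stationary_in[OF f y])
  qed
  also have "\<dots> = distr N MM F"
  proof (rule bind_return_distr')
    show "space N \<noteq> {}" using prob_space.not_empty[OF in_prob_algebraD(1)[OF N]] .
    show "F \<in> N \<rightarrow>\<^sub>M MM" unfolding measurable_cong_sets[OF in_prob_algebraD(2)[OF N] refl] by (rule F)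
  qed
  finally show ?thesis .
qed

private lemma undefined_space: "(\<lambda>_. undefined) \<in> space (PiM {0::nat..<0} (\<lambda>_. MM))"
  by (auto simp: space_PiM)

text \<open>\<open>C 0 (Suc t)\<close> governs the coordinates 0 to t, and its last extension writes
  a sample of the step law into coordinate t; projecting to t recovers that law.\<close>

private lemma distr_C_Suc:
  "distr (IT.C 0 (Suc t) (\<lambda>_. undefined)) MM (\<lambda>\<omega>. \<omega> t) =
     IT.C 0 t (\<lambda>_. undefined) \<bind> step_law Z A p (stationary_policy A f) z t"
proof -
  have sp: "space (IT.C 0 t (\<lambda>_. undefined)) = space (PiM {0..<t} (\<lambda>_. MM))"
    using IT.space_C[OF undefined_space, of t] by simp
  have sC: "sets (IT.C 0 t (\<lambda>_. undefined)) = sets (PiM {0..<t} (\<lambda>_. MM))"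
    using IT.sets_C[OF undefined_space, of t] by simp
  have ne: "space (IT.C 0 t (\<lambda>_. undefined)) \<noteq> {}"
    using IT.prob_space_C[OF undefined_space] prob_space.not_empty by blast
  have "distr (IT.C 0 (Suc t) (\<lambda>_. undefined)) MM (\<lambda>\<omega>. \<omega> t) =
     IT.C 0 t (\<lambda>_. undefined) \<bind> (\<lambda>\<omega>. distr (IT.eP t \<omega>) MM (\<lambda>\<omega>. \<omega> t))"
    using IT.measurable_eP[of t] ne
    by (simp, intro distr_bind[where K="PiM {0..<Suc t} (\<lambda>_. MM)"])
       (simp_all add: measurable_cong_sets[OF sC refl])
  also have "\<dots> = IT.C 0 t (\<lambda>_. undefined) \<bind> step_law Z A p (stationary_policy A f) z t"
  proof (rule bind_cong[OF refl])
    fix \<omega> assume "\<omega> \<in> space (IT.C 0 t (\<lambda>_. undefined))"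
    then have w: "\<omega> \<in> space (PiM {0..<t} (\<lambda>_. MM))" using sp by simp
    have sP: "sets (step_law Z A p (stationary_policy A f) z t \<omega>) = sets MM"
      using IT.sets_P[OF w] .
    have "fun_upd \<omega> t \<in> MM \<rightarrow>\<^sub>M PiM {0..<Suc t} (\<lambda>_. MM)"
      using w by (intro measurable_fun_upd[where J="{0..<t}"]) (auto simp: atLeast0_lessThan_Suc)
    then have "fun_upd \<omega> t \<in> step_law Z A p (stationary_policy A f) z t \<omega> \<rightarrow>\<^sub>M PiM {0..<Suc t} (\<lambda>_. MM)"
      by (simp add: measurable_cong_sets[OF sP refl])
    then show "distr (IT.eP t \<omega>) MM (\<lambda>\<omega>. \<omega> t) = step_law Z A p (stationary_policy A f) z t \<omega>"
      unfolding IT.eP_def by (subst distr_distr) (auto simp: comp_def intro!: distr_id2 sP[symmetric])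
  qed
  finally show ?thesis .
qed

text \<open>The Markov property: the step law at time t + 1 sees the history only through the pair
  at time t, whose law is known by induction.\<close>

private lemma distr_C_kernel_pow:
  "distr (IT.C 0 (Suc t) (\<lambda>_. undefined)) MM (\<lambda>\<omega>. \<omega> t) = distr (kernel_pow Z (\<lambda>x. p x (f x)) t z) MM F"
proof (induction t)
  case 0
  have "return (borel_on Z) z \<in> space (prob_algebra (borel_on Z))"
    using measurable_space[OF measurable_return_prob_space[of "borel_on Z"]] z by simp
  then have "step_law Z A p (stationary_policy A f) z 0 h = distr (return (borel_on Z) z) MM F" for h
    unfolding step_law_def by (simp add: step_law_distr)
  then show ?case
    unfolding distr_C_Suc IT.C.simps(1) by (simp only: bind_return[OF IT.P undefined_space] kernel_pow.simps)
next
  case (Suc t)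
  let ?C = "IT.C 0 (Suc t) (\<lambda>_. undefined)" and ?K = "\<lambda>x. p x (f x)"
  let ?L = "\<lambda>xa. distr (p (fst xa) (snd xa)) MM F"
  have sC: "sets ?C = sets (PiM {0..<Suc t} (\<lambda>_. MM))"
    using IT.sets_C[OF undefined_space, of "Suc t"] by (simp del: IT.C.simps)
  have spC: "space ?C = space (PiM {0..<Suc t} (\<lambda>_. MM))"
    using sC by (rule sets_eq_imp_space_eq)
  have ne: "space ?C \<noteq> {}"
    using IT.prob_space_C[OF undefined_space] prob_space.not_empty by blast
  have pL: "(\<lambda>xa. p (fst xa) (snd xa)) \<in> MM \<rightarrow>\<^sub>M prob_algebra (borel_on Z)"
    using kernel by (simp add: case_prod_beta')
  then have L: "?L \<in> MM \<rightarrow>\<^sub>M subprob_algebra MM"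
    by (intro measurable_prob_algebraD measurable_distr_prob_space2[OF pL]) (simp add: case_prod_beta')
  have comp: "(\<lambda>\<omega>. \<omega> t) \<in> ?C \<rightarrow>\<^sub>M MM"
    by (simp add: measurable_cong_sets[OF sC refl] del: IT.C.simps)
  have K: "?K \<in> borel_on Z \<rightarrow>\<^sub>M prob_algebra (borel_on Z)" using f by (rule policy_kernel)
  have pw: "kernel_pow Z ?K t z \<in> space (prob_algebra (borel_on Z))"
    using measurable_space[OF kernel_pow_measurable[OF K]] z by simp
  note pwD = in_prob_algebraD[OF pw]
  have "distr (IT.C 0 (Suc (Suc t)) (\<lambda>_. undefined)) MM (\<lambda>\<omega>. \<omega> (Suc t)) = ?C \<bind> (\<lambda>\<omega>. ?L (\<omega> t))"
    unfolding distr_C_Suc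
  proof (rule bind_cong[OF refl])
    fix \<omega> assume "\<omega> \<in> space ?C"
    then have "\<omega> t \<in> space MM"
      using measurable_space[OF comp] by simp
    then have "p (fst (\<omega> t)) (snd (\<omega> t)) \<in> space (prob_algebra (borel_on Z))"
      using measurable_space[OF pL] by simp
    then show "step_law Z A p (stationary_policy A f) z (Suc t) \<omega> = ?L (\<omega> t)"
      unfolding step_law_def by (simp add: step_law_distr)
  qed
  also have "\<dots> = distr ?C MM (\<lambda>\<omega>. \<omega> t) \<bind> ?L"
    using comp L ne by (intro bind_distr[symmetric])
  also have "\<dots> = distr (kernel_pow Z ?K t z) MM F \<bind> ?L"
    by (simp only: Suc)
  also have "\<dots> = kernel_pow Z ?K t z \<bind> (\<lambda>x. ?L (F x))"
    using L pwD F prob_space.not_empty[OF pwD(1)]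
    by (intro bind_distr) (simp_all add: measurable_cong_sets[OF pwD(2) refl])
  also have "\<dots> = distr (kernel_pow Z ?K t z \<bind> ?K) MM F"
    using measurable_prob_algebraD[OF K] F prob_space.not_empty[OF pwD(1)]
    by (simp, intro distr_bind[symmetric]) (auto simp: measurable_cong_sets[OF pwD(2) refl])
  finally show ?case by simp
qed

text \<open>Coordinate t is read off the restriction of the projective limit to {0..<Suc t}, which
  is the finite-horizon measure \<open>C 0 (Suc t)\<close>.\<close>

lemma distr_trajectory_law:
  "distr (trajectory_law Z A p (stationary_policy A f) z) MM (\<lambda>\<omega>. \<omega> t) =
     distr (kernel_pow Z (\<lambda>x. p x (f x)) t z) MM F"
proof -
  let ?J = "{0..<Suc t}"
  have up: "IT.up_to ?J = Suc t"
    unfolding IT.up_to_def by (rule Least_equality) (auto simp: not_less_eq_eq)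
  have sC: "sets (IT.C 0 (Suc t) (\<lambda>_. undefined)) = sets (PiM ?J (\<lambda>_. MM))"
    using IT.sets_C[OF undefined_space, of "Suc t"] by (simp del: IT.C.simps)
  have "distr (trajectory_law Z A p (stationary_policy A f) z) MM (\<lambda>\<omega>. \<omega> t)
      = distr (distr IT.PF.lim (PiM ?J (\<lambda>_. MM)) (\<lambda>x. restrict x ?J)) MM (\<lambda>\<omega>. \<omega> t)"
    unfolding trajectory_law_def
    by (subst distr_distr) (auto simp: comp_def measurable_cong_sets[OF IT.PF.sets_lim refl])
  also have "\<dots> = distr (IT.CI ?J) MM (\<lambda>\<omega>. \<omega> t)"
    by (subst IT.distr_lim) auto
  also have "\<dots> = distr (IT.C 0 (Suc t) (\<lambda>_. undefined)) MM (\<lambda>\<omega>. \<omega> t)"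
    unfolding IT.CI_def up
    by (subst distr_distr) (auto simp: comp_def measurable_cong_sets[OF sC refl] simp del: IT.C.simps)
  finally show ?thesis by (simp only: distr_C_kernel_pow)
qed

lemma sets_trajectory_law:
  "sets (trajectory_law Z A p (stationary_policy A f) z) = sets (PiM UNIV (\<lambda>_. MM))"
  unfolding trajectory_law_def by (rule IT.PF.sets_lim)

lemma avg_cost_stationary_eq:
  assumes bd: "\<And>x a. x \<in> Z \<Longrightarrow> a \<in> A \<Longrightarrow> \<bar>c x a\<bar> \<le> b"
  shows "avg_cost Z A p c (stationary_policy A f) z =
    limsup (\<lambda>T. ereal (1 / real T * (\<Sum>t<T. \<integral>x. c x (f x) \<partial>kernel_pow Z (\<lambda>x. p x (f x)) t z)))"
proof -
  let ?Tr = "trajectory_law Z A p (stationary_policy A f) z"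
  let ?c = "\<lambda>xa. c (fst xa) (snd xa)"
  have c: "?c \<in> borel_measurable MM" using cost by (simp add: case_prod_beta')
  have comp: "(\<lambda>\<omega>. \<omega> t) \<in> ?Tr \<rightarrow>\<^sub>M MM" for t
    by (simp add: measurable_cong_sets[OF sets_trajectory_law refl])
  have pw: "kernel_pow Z (\<lambda>x. p x (f x)) t z \<in> space (prob_algebra (borel_on Z))" for t
    using measurable_space[OF kernel_pow_measurable[OF policy_kernel[OF f]]] z by simp
  have Fm: "F \<in> kernel_pow Z (\<lambda>x. p x (f x)) t z \<rightarrow>\<^sub>M MM" for t
    by (simp add: measurable_cong_sets[OF in_prob_algebraD(2)[OF pw] refl])
  \<comment> \<open>The total mass of the trajectory law is read off its first marginal.\<close>
  have "prob_space (distr ?Tr MM (\<lambda>\<omega>. \<omega> 0))"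
    unfolding distr_trajectory_law
    by (rule prob_space.prob_space_distr[OF in_prob_algebraD(1)[OF pw] Fm])
  then interpret Tr: prob_space ?Tr
    using comp by (rule prob_space_distrD[rotated])
  have spMM: "space MM = Z \<times> A" by (simp add: space_pair_measure)
  have i: "integrable ?Tr (\<lambda>\<omega>. ?c (\<omega> t))" for t
    using measurable_space[OF comp] bd measurable_compose[OF comp c]
    by (intro Tr.integrable_const_bound[where B=b] AE_I2) (auto simp: spMM mem_Times_iff)
  have "(\<integral>\<omega>. ?c (\<omega> t) \<partial>?Tr) = (\<integral>x. c x (f x) \<partial>kernel_pow Z (\<lambda>x. p x (f x)) t z)" for t
  proof -
    have "(\<integral>\<omega>. ?c (\<omega> t) \<partial>?Tr) = (\<integral>xa. ?c xa \<partial>distr ?Tr MM (\<lambda>\<omega>. \<omega> t))"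
      by (rule integral_distr[symmetric, OF comp c])
    also have "\<dots> = (\<integral>x. ?c (F x) \<partial>kernel_pow Z (\<lambda>x. p x (f x)) t z)"
      unfolding distr_trajectory_law by (rule integral_distr[OF Fm c])
    finally show ?thesis by simp
  qed
  then show ?thesis
    unfolding avg_cost_def using i by simp
qed

end

end

text \<open>Kept abstract in the kernel and the cost because it is used for the original, the
  averaged and the finite model, with the same \<open>lam\<close> and \<open>cb\<close>.\<close>

locale minorized_MDP = MDP Z A p c
  for Z :: "'z::polish_space set" and A :: "'a::polish_space set"
    and p :: "'z \<Rightarrow> 'a \<Rightarrow> 'z measure" and c :: "'z \<Rightarrow> 'a \<Rightarrow> real" +
  fixes \<eta> :: "'z measure" and lam cb :: real
  assumes sets_\<eta>: "sets \<eta> = sets (borel_on Z)" and \<eta>_finite: "finite_measure \<eta>"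
    and \<eta>_mass: "measure \<eta> Z = 1 - lam"
    and minor: "\<And>z a B. z \<in> Z \<Longrightarrow> a \<in> A \<Longrightarrow> B \<in> sets (borel_on Z) \<Longrightarrow> measure \<eta> B \<le> measure (p z a) B"
    and lam: "0 < lam" "lam < 1"
    and cost_bound: "\<And>z a. z \<in> Z \<Longrightarrow> a \<in> A \<Longrightarrow> \<bar>c z a\<bar> \<le> cb"
begin

lemma doeblin_policy:
  assumes "f \<in> det_stationary Z A"
  shows "doeblin Z (\<lambda>x. p x (f x)) \<eta> lam"
  using policy_kernel[OF assms] Z_nonempty sets_\<eta> \<eta>_finite \<eta>_mass lam det_stationary_in[OF assms] minor
  by (intro doeblin.intro) auto

text \<open>The expected cost at time t deviates from the ergodic cost by at most 2 * cb * lam^t.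
  These deviations are summable, so the average up to T is off by O(1/T) and the limsup is a
  limit.\<close>

lemma avg_cost_ergodic_cost:
  assumes f: "f \<in> det_stationary Z A" and z: "z \<in> Z"
  shows "avg_cost Z A p c (stationary_policy A f) z = ereal (ergodic_cost Z p c f)"
proof -
  interpret K: doeblin Z "\<lambda>x. p x (f x)" \<eta> lam using f by (rule doeblin_policy)
  define a where "a t = (\<integral>x. c x (f x) \<partial>kernel_pow Z (\<lambda>x. p x (f x)) t z)" for t
  let ?r = "ergodic_cost Z p c f"
  have cb: "\<bar>c x (f x)\<bar> \<le> cb" if "x \<in> Z" for x
    using cost_bound[OF that det_stationary_in[OF f that]] .
  then have cb': "- cb \<le> c x (f x)" "c x (f x) \<le> - cb + 2 * cb" if "x \<in> Z" for x
    using that by (force simp: abs_le_iff)+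
  have a: "\<bar>a t - ?r\<bar> \<le> lam ^ t * (2 * cb)" for t
    using K.pow_converges_to_invariant[OF K.invariant_prob_space K.invariant_prob_bind policy_cost[OF f] cb' z, of t]
    unfolding a_def ergodic_cost_def by (simp add: abs_minus_commute)
  have "(\<lambda>T. 1 / real T * (\<Sum>t<T. a t)) \<longlonglongrightarrow> ?r"
  proof (rule LIM_zero_cancel, rule Lim_null_comparison)
    show "\<forall>\<^sub>F T in sequentially. norm (1 / real T * (\<Sum>t<T. a t) - ?r) \<le> (2 * cb / (1 - lam)) * inverse (real T)"
    proof (rule eventually_sequentiallyI[of 1])
      fix T :: nat assume T: "1 \<le> T"
      have "0 \<le> cb" using cb z by fastforce
      have "\<bar>\<Sum>t<T. (a t - ?r)\<bar> \<le> (\<Sum>t<T. \<bar>a t - ?r\<bar>)" by (rule sum_abs)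
      also have "\<dots> \<le> (\<Sum>t<T. lam ^ t * (2 * cb))" by (intro sum_mono a)
      also have "\<dots> = (\<Sum>t<T. lam ^ t) * (2 * cb)" by (simp add: sum_distrib_right)
      also have "\<dots> \<le> 1 / (1 - lam) * (2 * cb)"
      proof (rule mult_right_mono)
        show "(\<Sum>t<T. lam ^ t) \<le> 1 / (1 - lam)"
          using lam by (simp add: sum_gp_strict divide_right_mono)
      qed (use \<open>0 \<le> cb\<close> in simp)
      finally have *: "\<bar>\<Sum>t<T. (a t - ?r)\<bar> \<le> 2 * cb / (1 - lam)" by simp
      have "1 / real T * (\<Sum>t<T. a t) - ?r = inverse (real T) * (\<Sum>t<T. (a t - ?r))"
        using T by (simp add: sum_subtractf field_simps)
      then show "norm (1 / real T * (\<Sum>t<T. a t) - ?r) \<le> (2 * cb / (1 - lam)) * inverse (real T)"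
        using mult_left_mono[OF *, of "inverse (real T)"] by (simp add: abs_mult mult.commute)
    qed
    show "(\<lambda>T. (2 * cb / (1 - lam)) * inverse (real T)) \<longlonglongrightarrow> 0"
      by (intro tendsto_mult_right_zero lim_inverse_n)
  qed
  then have "(\<lambda>T. ereal (1 / real T * (\<Sum>t<T. a t))) \<longlonglongrightarrow> ereal ?r"
    by simp
  then have "limsup (\<lambda>T. ereal (1 / real T * (\<Sum>t<T. a t))) = ereal ?r"
    by (intro lim_imp_Limsup) auto
  then show ?thesis
    using avg_cost_stationary_eq[OF f z cost_bound] by (simp add: a_def)
qed

lemma avg_optimal_ergodic_cost_le:
  assumes f: "avg_optimal Z A p c f" and g: "g \<in> det_stationary Z A"
  shows "ergodic_cost Z p c f \<le> ergodic_cost Z p c g"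
proof -
  obtain z where z: "z \<in> Z" using Z_nonempty by auto
  have "avg_cost Z A p c (stationary_policy A f) z \<le> avg_cost Z A p c (stationary_policy A g) z"
    using f z stationary_policy_in[OF g] by (auto simp: avg_optimal_def intro: INF_lower)
  then show ?thesis
    using f z g by (simp add: avg_cost_ergodic_cost avg_optimal_def)
qed

text \<open>Under the invariant measure the expected one-step increment of a bounded
  \<open>u\<close> integrates to zero, so it may be added to the cost.\<close>

lemma ergodic_cost_drift:
  fixes u :: "'z \<Rightarrow> real"
  assumes f: "f \<in> det_stationary Z A"
    and u: "u \<in> borel_measurable (borel_on Z)" "\<And>x. x \<in> Z \<Longrightarrow> \<bar>u x\<bar> \<le> b"
  shows "ergodic_cost Z p c f =
    (\<integral>x. c x (f x) + (\<integral>y. u y \<partial>p x (f x)) - u x \<partial>invariant_prob Z (\<lambda>x. p x (f x)))"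
    and "(\<lambda>x. c x (f x) + (\<integral>y. u y \<partial>p x (f x)) - u x)
      \<in> borel_measurable (invariant_prob Z (\<lambda>x. p x (f x)))"
proof -
  interpret K: doeblin Z "\<lambda>x. p x (f x)" \<eta> lam using f by (rule doeblin_policy)
  let ?K = "\<lambda>x. p x (f x)" and ?\<mu> = "invariant_prob Z (\<lambda>x. p x (f x))"
  note D = in_prob_algebraD[OF K.invariant_prob_space]
  interpret \<mu>: prob_space ?\<mu> by (rule D(1))
  have m: "(\<lambda>x. c x (f x)) \<in> borel_measurable ?\<mu>" "u \<in> borel_measurable ?\<mu>"
    "(\<lambda>x. \<integral>y. u y \<partial>?K x) \<in> borel_measurable ?\<mu>"
    using policy_cost[OF f] u(1) measurable_integral_kernel[OF K.K u(1)]
    by (simp_all add: measurable_cong_sets[OF D(2) refl])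
  show "(\<lambda>x. c x (f x) + (\<integral>y. u y \<partial>?K x) - u x) \<in> borel_measurable ?\<mu>"
    using m by measurable
  have ub: "\<bar>\<integral>y. u y \<partial>?K x\<bar> \<le> b" if "x \<in> Z" for x
    using u in_prob_algebraD[OF K.K_space[OF that]]
    by (intro prob_space.integral_abs_le(2)) (simp_all add: measurable_cong_sets[OF in_prob_algebraD(2)[OF K.K_space[OF that]] refl])
  have i: "integrable ?\<mu> (\<lambda>x. c x (f x))" "integrable ?\<mu> u" "integrable ?\<mu> (\<lambda>x. \<integral>y. u y \<partial>?K x)"
    using cost_bound det_stationary_in[OF f] D(3) u(2) ub
    by (auto intro: \<mu>.integral_abs_le(1)[OF m(1), of cb] \<mu>.integral_abs_le(1)[OF m(2), of b]
        \<mu>.integral_abs_le(1)[OF m(3), of b])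
  have "(\<integral>x. (\<integral>y. u y \<partial>?K x) \<partial>?\<mu>) = (\<integral>x. u x \<partial>(?\<mu> \<bind> ?K))"
    using u by (intro integral_bind_prob[symmetric, OF K.invariant_prob_space K.K, where b=b]) auto
  then have "(\<integral>x. (\<integral>y. u y \<partial>?K x) \<partial>?\<mu>) = (\<integral>x. u x \<partial>?\<mu>)"
    by (simp only: K.invariant_prob_bind)
  then show "ergodic_cost Z p c f = (\<integral>x. c x (f x) + (\<integral>y. u y \<partial>?K x) - u x \<partial>?\<mu>)"
    unfolding ergodic_cost_def using i by simp
qed

text \<open>Integrating a one-sided Poisson inequality against the invariant measure bounds the
  average cost.\<close>

lemma ergodic_cost_le:
  fixes u :: "'z \<Rightarrow> real"
  assumes f: "f \<in> det_stationary Z A"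
    and u: "u \<in> borel_measurable (borel_on Z)" "\<And>x. x \<in> Z \<Longrightarrow> \<bar>u x\<bar> \<le> b"
    and le: "\<And>x. x \<in> Z \<Longrightarrow> c x (f x) + (\<integral>y. u y \<partial>p x (f x)) \<le> u x + r"
  shows "ergodic_cost Z p c f \<le> r"
proof -
  interpret K: doeblin Z "\<lambda>x. p x (f x)" \<eta> lam using f by (rule doeblin_policy)
  note D = in_prob_algebraD[OF K.invariant_prob_space]
  interpret \<mu>: prob_space "invariant_prob Z (\<lambda>x. p x (f x))" by (rule D(1))
  let ?h = "\<lambda>x. c x (f x) + (\<integral>y. u y \<partial>p x (f x)) - u x"
  \<comment> \<open>This crude lower bound serves integrability only.\<close>
  have lo: "- cb - b - b \<le> ?h x" if x: "x \<in> Z" for x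
  proof -
    note E = in_prob_algebraD[OF K.K_space[OF x]]
    have "\<bar>\<integral>y. u y \<partial>p x (f x)\<bar> \<le> b"
      using u E by (intro prob_space.integral_abs_le(2)) (simp_all add: measurable_cong_sets[OF E(2) refl])
    then show ?thesis
      using cost_bound[OF x det_stationary_in[OF f x]] u(2)[OF x] by (simp add: abs_le_iff)
  qed
  have "(\<integral>x. ?h x \<partial>invariant_prob Z (\<lambda>x. p x (f x))) \<le> r"
    using le lo D(3)
    by (intro \<mu>.integral_between(3)[where l="- cb - b - b"] ergodic_cost_drift(2)[OF f u]) (auto simp: algebra_simps)
  then show ?thesis by (simp add: ergodic_cost_drift(1)[OF f u])
qed

text \<open>Changing the sign of the cost and of \<open>u\<close> turns the upper bound
  \<open>ergodic_cost_le\<close> into the lower bound \<open>ergodic_cost_ge\<close>.\<close>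

lemma minorized_MDP_uminus: "minorized_MDP Z A p (\<lambda>z a. - c z a) \<eta> lam cb"
proof -
  have "(\<lambda>(z, a). - c z a) \<in> borel_on Z \<Otimes>\<^sub>M borel_on A \<rightarrow>\<^sub>M borel"
    using cost by (simp add: case_prod_beta')
  then show ?thesis
    using Z_borel Z_nonempty A_borel A_nonempty kernel sets_\<eta> \<eta>_finite \<eta>_mass minor lam cost_bound
    by (intro minorized_MDP.intro MDP.intro minorized_MDP_axioms.intro) auto
qed

lemma ergodic_cost_ge:
  fixes u :: "'z \<Rightarrow> real"
  assumes f: "f \<in> det_stationary Z A"
    and u: "u \<in> borel_measurable (borel_on Z)" "\<And>x. x \<in> Z \<Longrightarrow> \<bar>u x\<bar> \<le> b"
    and le: "\<And>x. x \<in> Z \<Longrightarrow> u x + r \<le> c x (f x) + (\<integral>y. u y \<partial>p x (f x))"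
  shows "r \<le> ergodic_cost Z p c f"
  using minorized_MDP.ergodic_cost_le[OF minorized_MDP_uminus f, of "\<lambda>x. - u x" b "- r"] u le
  by (simp add: ergodic_cost_def algebra_simps)

end

section \<open>Approximate solutions of the average cost optimality equation\<close>

lemma sets_borel_on_finite:
  fixes X :: "'z::t1_space set"
  assumes "finite X"
  shows "sets (borel_on X) = Pow X"
proof -
  have "B \<in> (\<inter>) X ` sets borel" if "B \<subseteq> X" for B
    using that finite_subset[OF that assms] by (intro image_eqI[of _ _ B]) (auto intro: borel_closed finite_imp_closed)
  then show ?thesis by (auto simp: sets_restrict_space)
qed

lemma measurable_borel_on_finite:
  fixes X :: "'z::t1_space set"
  assumes "finite X" and "\<And>x. x \<in> X \<Longrightarrow> f x \<in> space N"
  shows "f \<in> borel_on X \<rightarrow>\<^sub>M N"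
  using assms by (auto simp: measurable_def sets_borel_on_finite)

lemma finite_bounded_real:
  fixes u :: "'z \<Rightarrow> real"
  assumes "finite X"
  shows "\<exists>b. \<forall>x\<in>X. \<bar>u x\<bar> \<le> b"
proof -
  have "\<bar>u x\<bar> \<le> (\<Sum>y\<in>X. \<bar>u y\<bar>)" if "x \<in> X" for x
    using assms that by (intro member_le_sum) auto
  then show ?thesis by blast
qed

context minorized_MDP
begin

lemma const_det_stationary: "a \<in> A \<Longrightarrow> (\<lambda>_. a) \<in> det_stationary Z A"
  by (simp add: det_stationary_def)

lemma p_in_prob_algebra:
  assumes "x \<in> Z" "a \<in> A"
  shows "p x a \<in> space (prob_algebra (borel_on Z))"
  using doeblin.K_space[OF doeblin_policy[OF const_det_stationary[OF assms(2)]] assms(1)] .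

lemma integrable_p:
  fixes u :: "'z \<Rightarrow> real"
  assumes "x \<in> Z" "a \<in> A" and u: "u \<in> borel_measurable (borel_on Z)" "\<And>y. y \<in> Z \<Longrightarrow> \<bar>u y\<bar> \<le> b"
  shows "integrable (p x a) u" "\<bar>\<integral>y. u y \<partial>p x a\<bar> \<le> b"
proof -
  note D = in_prob_algebraD[OF p_in_prob_algebra[OF assms(1,2)]]
  have m: "u \<in> borel_measurable (p x a)" using u(1) by (simp add: measurable_cong_sets[OF D(2) refl])
  have "\<bar>u y\<bar> \<le> b" if "y \<in> space (p x a)" for y using u(2) that by (simp add: D(3))
  from prob_space.integral_abs_le[OF D(1) m this]
  show "integrable (p x a) u" "\<bar>\<integral>y. u y \<partial>p x a\<bar> \<le> b" by auto
qed

lemma integrable_\<eta>: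
  fixes u :: "'z \<Rightarrow> real"
  assumes u: "u \<in> borel_measurable (borel_on Z)" "\<And>y. y \<in> Z \<Longrightarrow> \<bar>u y\<bar> \<le> b"
  shows "integrable \<eta> u"
proof -
  interpret \<eta>: finite_measure \<eta> by (rule \<eta>_finite)
  show ?thesis
    using u sets_eq_imp_space_eq[OF sets_\<eta>]
    by (intro \<eta>.integrable_const_bound[where B=b] AE_I2) (simp_all add: measurable_cong_sets[OF sets_\<eta> refl])
qed

text \<open>Value iteration for the kernel \<open>p - \<eta>\<close> of mass \<open>lam\<close> is a contraction, so its iterates are
  almost fixed; the constant removed with \<open>\<eta>\<close> becomes the average cost.\<close>

lemma approximate_optimality_equation:
  assumes fin: "finite Z" and \<epsilon>: "\<epsilon> > 0"
  obtains u :: "'z \<Rightarrow> real" and r g where "g \<in> det_stationary Z A"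
    and "\<And>x a. x \<in> Z \<Longrightarrow> a \<in> A \<Longrightarrow> u x + (r - \<epsilon>) \<le> c x a + (\<integral>y. u y \<partial>p x a)"
    and "\<And>x. x \<in> Z \<Longrightarrow> c x (g x) + (\<integral>y. u y \<partial>p x (g x)) \<le> u x + (r + \<epsilon>)"
proof -
  have meas: "u \<in> borel_measurable (borel_on Z)" for u :: "'z \<Rightarrow> real"
    using fin by (intro measurable_borel_on_finite) auto
  \<comment> \<open>The one-step cost operator for the kernel with its common part
    \<open>\<eta>\<close> removed; \<open>T\<close> is the corresponding value iteration.\<close>
  define H where "H u x a = c x a + (\<integral>y. u y \<partial>p x a) - (\<integral>y. u y \<partial>\<eta>)" for u x a
  define T where "T u x = (INF a\<in>A. H u x a)" for u x
  have bdd: "bdd_below (H u x ` A)" if x: "x \<in> Z" for u x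
  proof -
    obtain b where b: "\<And>y. y \<in> Z \<Longrightarrow> \<bar>u y\<bar> \<le> b"
      using finite_bounded_real[OF fin, of u] by auto
    have "- cb - b - (\<integral>y. u y \<partial>\<eta>) \<le> H u x a" if a: "a \<in> A" for a
      using integrable_p(2)[OF x a meas[of u] b] cost_bound[OF x a] by (simp add: H_def abs_le_iff)
    then show ?thesis by (rule bdd_belowI2)
  qed
  have H_diff: "H u x a \<le> H v x a + lam * B"
    if x: "x \<in> Z" and a: "a \<in> A" and B: "\<And>y. y \<in> Z \<Longrightarrow> \<bar>u y - v y\<bar> \<le> B" for u v x a B
  proof -
    interpret K: doeblin Z "\<lambda>x. p x a" \<eta> lam
      using doeblin_policy[OF const_det_stationary[OF a]] .
    obtain bu bv where bu: "\<And>y. y \<in> Z \<Longrightarrow> \<bar>u y\<bar> \<le> bu" and bv: "\<And>y. y \<in> Z \<Longrightarrow> \<bar>v y\<bar> \<le> bv"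
      using finite_bounded_real[OF fin, of u] finite_bounded_real[OF fin, of v] by auto
    \<comment> \<open>The difference u - v has values in [-B, B], an interval that starts at -B and
      has length 2 * B, so the upper bound is B * lam.\<close>
    have "(\<integral>y. u y - v y \<partial>p x a) - (\<integral>y. u y - v y \<partial>\<eta>) \<le> (- B + 2 * B) * lam"
      using B by (intro K.integral_kernel_osc(2)[OF meas x]) (force simp: abs_le_iff)+
    then show ?thesis
      using integrable_p(1)[OF x a meas bu] integrable_p(1)[OF x a meas bv]
        integrable_\<eta>[OF meas bu] integrable_\<eta>[OF meas bv]
      by (simp add: H_def algebra_simps)
  qed
  have T_diff: "T u x \<le> T v x + lam * B"
    if x: "x \<in> Z" and B: "\<And>y. y \<in> Z \<Longrightarrow> \<bar>u y - v y\<bar> \<le> B" for u v x B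
  proof -
    have "T u x - lam * B \<le> T v x"
      unfolding T_def[of v]
    proof (rule cINF_greatest[OF A_nonempty])
      fix a assume a: "a \<in> A"
      have "T u x \<le> H u x a" unfolding T_def by (rule cINF_lower[OF bdd[OF x] a])
      then show "T u x - lam * B \<le> H v x a" using H_diff[OF x a, of u v B] B by simp
    qed
    then show ?thesis by simp
  qed
  define U where "U k = (T ^^ k) (\<lambda>_. 0)" for k
  obtain B where B: "\<And>x. x \<in> Z \<Longrightarrow> \<bar>U 1 x - U 0 x\<bar> \<le> B"
    using finite_bounded_real[OF fin, of "\<lambda>x. U 1 x - U 0 x"] by auto
  have step: "\<bar>U (Suc k) x - U k x\<bar> \<le> lam ^ k * B" if "x \<in> Z" for k x
    using that
  proof (induction k arbitrary: x)
    case 0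
    then show ?case using B by simp
  next
    case (Suc k)
    have eq: "U (Suc k) = T (U k)" for k by (simp add: U_def)
    have "T (U (Suc k)) x \<le> T (U k) x + lam * (lam ^ k * B)"
      using Suc by (intro T_diff) auto
    moreover have "T (U k) x \<le> T (U (Suc k)) x + lam * (lam ^ k * B)"
      using Suc by (intro T_diff) (auto simp: abs_minus_commute)
    ultimately show ?case by (simp add: eq abs_le_iff algebra_simps)
  qed
  have "(\<lambda>k. lam ^ k * B) \<longlonglongrightarrow> 0"
    using lam by (intro tendsto_mult_left_zero LIMSEQ_power_zero) auto
  then have "\<exists>k. norm (lam ^ k * B - 0) < \<epsilon> / 2"
    using LIMSEQ_D[of "\<lambda>k. lam ^ k * B" 0 "\<epsilon> / 2"] \<epsilon> by (meson half_gt_zero order_refl)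
  then obtain k where k: "lam ^ k * B < \<epsilon> / 2"
    by (metis abs_ge_self diff_zero order_le_less_trans real_norm_def)
  define u where "u = U k"
  have Tu: "\<bar>T u x - u x\<bar> \<le> \<epsilon> / 2" if "x \<in> Z" for x
    using step[OF that, of k] k by (simp add: u_def U_def)
  \<comment> \<open>Moving the integral over \<open>\<eta>\<close> to the other side turns "T u is
    nearly u" into an optimality equation with constant r.\<close>
  define r where "r = (\<integral>y. u y \<partial>\<eta>)"
  \<comment> \<open>A near-minimizer loses \<epsilon>/2, and the inexact fixed point loses the other
    half. On a finite state space any such choice of actions is a measurable policy.\<close>
  have "\<exists>a\<in>A. H u x a < T u x + \<epsilon> / 2" if "x \<in> Z" for x
    using cINF_less_iff[OF A_nonempty bdd[OF that], of u "T u x + \<epsilon> / 2"] \<epsilon> by (simp add: T_def)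
  then obtain g where g: "\<And>x. x \<in> Z \<Longrightarrow> g x \<in> A" "\<And>x. x \<in> Z \<Longrightarrow> H u x (g x) < T u x + \<epsilon> / 2"
    by metis
  show thesis
  proof (rule that)
    show "g \<in> det_stationary Z A"
      unfolding det_stationary_def using g(1) fin by (intro measurable_borel_on_finite) auto
    show "u x + (r - \<epsilon>) \<le> c x a + (\<integral>y. u y \<partial>p x a)" if "x \<in> Z" "a \<in> A" for x a
    proof -
      have "T u x \<le> H u x a" unfolding T_def by (rule cINF_lower[OF bdd[OF that(1)] that(2)])
      then show ?thesis using Tu[OF that(1)] \<epsilon> unfolding H_def r_def abs_le_iff by linarith
    qed
    show "c x (g x) + (\<integral>y. u y \<partial>p x (g x)) \<le> u x + (r + \<epsilon>)" if "x \<in> Z" for x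
      using g(2)[OF that] Tu[OF that] unfolding H_def r_def abs_le_iff by linarith
  qed
qed

end

section \<open>Quantized models\<close>

text \<open>Distances are kept out of this locale: how much \<open>p\<close> and \<open>c\<close>
  vary over a cell enters later through the bounds \<open>wp\<close> and \<open>wc\<close>.\<close>

locale quantized_MDP = minorized_MDP Z A p c \<eta> lam cb
  for Z :: "'z::polish_space set" and A :: "'a::polish_space set"
    and p :: "'z \<Rightarrow> 'a \<Rightarrow> 'z measure" and c :: "'z \<Rightarrow> 'a \<Rightarrow> real"
    and \<eta> :: "'z measure" and lam cb :: real +
  fixes Zn :: "'z set" and Q :: "'z \<Rightarrow> 'z" and \<nu> :: "'z measure"
  assumes Zn: "Zn \<subseteq> Z" "finite Zn" "Zn \<noteq> {}"
    and Q [measurable]: "Q \<in> borel_on Z \<rightarrow>\<^sub>M borel_on Zn" and Q_id: "\<And>y. y \<in> Zn \<Longrightarrow> Q y = y"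
    and \<nu>: "\<nu> \<in> space (prob_algebra (borel_on Z))"
    and cell_pos: "\<And>y. y \<in> Zn \<Longrightarrow> measure \<nu> (cell Z Q y) > 0"
begin

text \<open>\<open>q\<close> and \<open>b\<close> form the averaged model on \<open>Z\<close>; for a
  given action both depend on the state only through its cell.\<close>

abbreviation "q \<equiv> averaged_kernel Z Q \<nu> p"
abbreviation "b \<equiv> (\<lambda>z a. finite_cost Z Q \<nu> c (Q z) a)"
abbreviation "pn \<equiv> finite_kernel Z Zn Q \<nu> p"
abbreviation "cn \<equiv> finite_cost Z Q \<nu> c"
abbreviation "\<nu>c \<equiv> cell_measure Z Q \<nu>"

lemma Q_in: "z \<in> Z \<Longrightarrow> Q z \<in> Zn"
  using measurable_space[OF Q] by simp

lemma cell_sets: "cell Z Q y \<in> sets (borel_on Z)"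
proof (cases "y \<in> Zn")
  case True
  have "cell Z Q y = Q -` {y} \<inter> space (borel_on Z)" by (auto simp: cell_def)
  also have "\<dots> \<in> sets (borel_on Z)"
    using True Zn by (intro measurable_sets[OF Q]) (simp add: sets_borel_on_finite)
  finally show ?thesis .
next
  case False
  then have "cell Z Q y = {}" using Q_in by (auto simp: cell_def)
  then show ?thesis by simp
qed

lemma cell_measure_in:
  assumes "y \<in> Zn"
  shows "\<nu>c y \<in> space (prob_algebra (borel_on Z))"
proof -
  interpret \<nu>: prob_space \<nu> using \<nu> by (rule in_prob_algebraD)
  have "prob_space (\<nu>c y)"
    unfolding cell_measure_def using cell_pos[OF assms]
    by (intro prob_space_uniform_measure) (simp_all add: \<nu>.emeasure_eq_measure)
  then show ?thesis
    using in_prob_algebraD(2)[OF \<nu>] by (simp add: space_prob_algebra cell_measure_def)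
qed

lemma AE_cell: "AE x in \<nu>c y. x \<in> cell Z Q y"
  unfolding cell_measure_def using cell_sets[of y] in_prob_algebraD(2)[OF \<nu>]
  by (intro AE_uniform_measureI) auto

lemma cell_kernel: "(\<lambda>z. \<nu>c (Q z)) \<in> borel_on Z \<rightarrow>\<^sub>M prob_algebra (borel_on Z)"
  using Zn(2) cell_measure_in by (intro measurable_compose[OF Q] measurable_borel_on_finite) auto

lemma p_action:
  assumes "a \<in> A"
  shows "(\<lambda>x. p x a) \<in> borel_on Z \<rightarrow>\<^sub>M prob_algebra (borel_on Z)"
  using policy_kernel[OF const_det_stationary[OF assms]] .

lemma c_action:
  assumes "a \<in> A"
  shows "(\<lambda>x. c x a) \<in> borel_measurable (borel_on Z)"
  using policy_cost[OF const_det_stationary[OF assms]] .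

lemma q_kernel: "(\<lambda>(z, a). q z a) \<in> borel_on Z \<Otimes>\<^sub>M borel_on A \<rightarrow>\<^sub>M prob_algebra (borel_on Z)"
proof -
  have "(\<lambda>w. \<nu>c (Q (fst w)) \<bind> (\<lambda>x. p x (snd w))) \<in> borel_on Z \<Otimes>\<^sub>M borel_on A \<rightarrow>\<^sub>M prob_algebra (borel_on Z)"
  proof (rule measurable_bind_prob_space2)
    show "(\<lambda>w. \<nu>c (Q (fst w))) \<in> borel_on Z \<Otimes>\<^sub>M borel_on A \<rightarrow>\<^sub>M prob_algebra (borel_on Z)"
      by (rule measurable_compose[OF measurable_fst cell_kernel])
    have "(\<lambda>v. (snd v, snd (fst v))) \<in> (borel_on Z \<Otimes>\<^sub>M borel_on A) \<Otimes>\<^sub>M borel_on Z \<rightarrow>\<^sub>M borel_on Z \<Otimes>\<^sub>M borel_on A"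
      by measurable
    from measurable_compose[OF this kernel]
    show "(\<lambda>(w, x). p x (snd w)) \<in> (borel_on Z \<Otimes>\<^sub>M borel_on A) \<Otimes>\<^sub>M borel_on Z \<rightarrow>\<^sub>M prob_algebra (borel_on Z)"
      by (simp add: case_prod_beta')
  qed
  then show ?thesis by (simp add: averaged_kernel_def case_prod_beta')
qed

text \<open>For joint measurability in state and action, the parameter integral is rewritten as the
  integral of \<open>c\<close> against a kernel on pairs, with the action as a fixed second
  component.\<close>

lemma b_cost: "(\<lambda>(z, a). b z a) \<in> borel_measurable (borel_on Z \<Otimes>\<^sub>M borel_on A)"
proof -
  let ?MM = "borel_on Z \<Otimes>\<^sub>M borel_on A"
  let ?L = "\<lambda>w. distr (\<nu>c (Q (fst w))) ?MM (\<lambda>x. (x, snd w))"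
  have "?L \<in> ?MM \<rightarrow>\<^sub>M prob_algebra ?MM"
  proof (rule measurable_distr_prob_space2)
    show "(\<lambda>w. \<nu>c (Q (fst w))) \<in> ?MM \<rightarrow>\<^sub>M prob_algebra (borel_on Z)"
      by (rule measurable_compose[OF measurable_fst cell_kernel])
    show "(\<lambda>(w, x). (x, snd w)) \<in> ?MM \<Otimes>\<^sub>M borel_on Z \<rightarrow>\<^sub>M ?MM"
      by (simp add: case_prod_beta')
  qed
  then have "(\<lambda>w. \<integral>v. (case v of (x, a) \<Rightarrow> c x a) \<partial>?L w) \<in> borel_measurable ?MM"
    by (rule measurable_integral_kernel[OF _ cost])
  moreover have "(\<integral>v. (case v of (x, a) \<Rightarrow> c x a) \<partial>?L w) = b (fst w) (snd w)" if "w \<in> space ?MM" for w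
  proof -
    have w: "fst w \<in> Z" "snd w \<in> A" using that by (auto simp: space_pair_measure)
    have "(\<lambda>x. (x, snd w)) \<in> \<nu>c (Q (fst w)) \<rightarrow>\<^sub>M ?MM"
      using w unfolding measurable_cong_sets[OF in_prob_algebraD(2)[OF cell_measure_in[OF Q_in[OF w(1)]]] refl]
      by (intro measurable_Pair2') simp
    then show ?thesis
      unfolding finite_cost_def by (subst integral_distr[OF _ cost]) simp_all
  qed
  ultimately have "(\<lambda>w. b (fst w) (snd w)) \<in> borel_measurable ?MM"
    by (subst measurable_cong[symmetric]) auto
  then show ?thesis by (simp add: case_prod_beta')
qed

lemma measure_q:
  assumes "z \<in> Z" "a \<in> A" "D \<in> sets (borel_on Z)"
  shows "measure (q z a) D = (\<integral>x. measure (p x a) D \<partial>\<nu>c (Q z))"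
  unfolding averaged_kernel_def
  by (rule measure_bind_prob[OF cell_measure_in[OF Q_in[OF assms(1)]] p_action[OF assms(2)] assms(3)])

lemma AE_cell_in:
  assumes "z \<in> Z"
  shows "AE x in \<nu>c (Q z). x \<in> Z \<and> Q x = Q z"
  using AE_cell[of "Q z"] by (simp add: cell_def)

lemma measure_p_meas:
  assumes "y \<in> Zn" "a \<in> A" "D \<in> sets (borel_on Z)"
  shows "(\<lambda>x. measure (p x a) D) \<in> borel_measurable (\<nu>c y)"
    and "integrable (\<nu>c y) (\<lambda>x. measure (p x a) D)"
proof -
  note E = in_prob_algebraD[OF cell_measure_in[OF assms(1)]]
  show m: "(\<lambda>x. measure (p x a) D) \<in> borel_measurable (\<nu>c y)"
    unfolding measurable_cong_sets[OF E(2) refl]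
    by (rule measurable_compose[OF p_action[OF assms(2)] measurable_measure_prob_algebra[OF assms(3)]])
  show "integrable (\<nu>c y) (\<lambda>x. measure (p x a) D)"
    using m E assms prob_space.prob_le_1[OF in_prob_algebraD(1)[OF p_in_prob_algebra]]
    by (intro prob_space.integral_abs_le(1)[where b=1]) auto
qed

text \<open>An average of measures that all dominate \<open>\<eta>\<close> dominates
  \<open>\<eta>\<close>, and averaging preserves the bound on the cost.\<close>

lemma q_minorized: "minorized_MDP Z A q b \<eta> lam cb"
proof (intro minorized_MDP.intro MDP.intro minorized_MDP_axioms.intro q_kernel b_cost)
  fix z a B assume *: "z \<in> Z" "a \<in> A" "B \<in> sets (borel_on Z)"
  note E = in_prob_algebraD[OF cell_measure_in[OF Q_in[OF *(1)]]]
  show "measure \<eta> B \<le> measure (q z a) B"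
    unfolding measure_q[OF *] using minor *(2,3) E
    by (intro prob_space.integral_ge_const measure_p_meas[OF Q_in[OF *(1)]] AE_I2) auto
next
  fix z a assume *: "z \<in> Z" "a \<in> A"
  note E = in_prob_algebraD[OF cell_measure_in[OF Q_in[OF *(1)]]]
  show "\<bar>b z a\<bar> \<le> cb"
    unfolding finite_cost_def using cost_bound *(2) E c_action[OF *(2)]
    by (intro prob_space.integral_abs_le(2)) (auto simp: measurable_cong_sets[OF E(2) refl])
qed (use Z_borel Z_nonempty A_borel A_nonempty sets_\<eta> \<eta>_finite \<eta>_mass lam in auto)

sublocale qm: minorized_MDP Z A q b \<eta> lam cb
  by (rule q_minorized)

section \<open>The finite model as the image of the averaged model\<close>

lemma Q_Q: "z \<in> Z \<Longrightarrow> Q (Q z) = Q z"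
  using Q_in Q_id by blast

lemma q_Q: "z \<in> Z \<Longrightarrow> q (Q z) a = q z a"
  by (simp add: averaged_kernel_def Q_Q)

text \<open>The weight of a grid point under \<open>pn\<close> is the averaged probability of its
  cell, which is the mass that \<open>q\<close> gives to the preimage of the point. Facts about the
  finite model are derived from this push-forward form.\<close>

lemma finite_kernel_distr:
  assumes y: "y \<in> Zn" and a: "a \<in> A"
  shows "pn y a = distr (q y a) (borel_on Zn) Q"
proof (rule measure_eqI_finite[of _ Zn])
  have y': "y \<in> Z" using y Zn by auto
  note D = in_prob_algebraD[OF qm.p_in_prob_algebra[OF y' a]]
  interpret q: prob_space "q y a" by (rule D(1))
  show "sets (pn y a) = Pow Zn" by (simp add: finite_kernel_def sets_point_measure)
  show "sets (distr (q y a) (borel_on Zn) Q) = Pow Zn" using Zn(2) by (simp add: sets_borel_on_finite)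
  show "finite Zn" by (rule Zn)
  fix w assume w: "w \<in> Zn"
  have Qm: "Q \<in> q y a \<rightarrow>\<^sub>M borel_on Zn" unfolding measurable_cong_sets[OF D(2) refl] by (rule Q)
  have "emeasure (distr (q y a) (borel_on Zn) Q) {w} = emeasure (q y a) (Q -` {w} \<inter> space (q y a))"
    using w Zn by (intro emeasure_distr[OF Qm]) (simp add: sets_borel_on_finite)
  also have "Q -` {w} \<inter> space (q y a) = cell Z Q w" using D(3) by (auto simp: cell_def)
  also have "emeasure (q y a) (cell Z Q w) = ennreal (\<integral>x. measure (p x a) (cell Z Q w) \<partial>\<nu>c y)"
    using measure_q[OF y' a cell_sets] Q_id[OF y] by (simp add: q.emeasure_eq_measure)
  finally show "emeasure (pn y a) {w} = emeasure (distr (q y a) (borel_on Zn) Q) {w}"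
    using w Zn by (simp add: finite_kernel_def emeasure_point_measure_finite)
qed

definition "\<eta>n = distr \<eta> (borel_on Zn) Q"

lemma Q_\<eta>: "Q \<in> \<eta> \<rightarrow>\<^sub>M borel_on Zn"
  unfolding measurable_cong_sets[OF sets_\<eta> refl] by (rule Q)

text \<open>The inequality between \<open>\<eta>\<close> and \<open>q\<close> is evaluated on
  preimages under \<open>Q\<close>; hence the choice of \<open>\<eta>n\<close> as an image measure,
  with unchanged mass.\<close>

lemma pn_minorized: "minorized_MDP Zn A pn cn \<eta>n lam cb"
proof (intro minorized_MDP.intro MDP.intro minorized_MDP_axioms.intro)
  let ?MM = "borel_on Z \<Otimes>\<^sub>M borel_on A" and ?Mn = "borel_on Zn \<Otimes>\<^sub>M borel_on A"
  show "Zn \<in> sets borel" using Zn by (simp add: finite_imp_closed borel_closed)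
  have "id \<in> borel_on Zn \<rightarrow>\<^sub>M borel_on Z"
    using Zn by (intro measurable_borel_on_finite) auto
  from measurable_Pair[OF measurable_compose[OF measurable_fst this] measurable_snd[of "borel_on Zn" "borel_on A"]]
  have incl: "(\<lambda>w. w) \<in> ?Mn \<rightarrow>\<^sub>M ?MM"
    by simp
  have sp: "space ?Mn = Zn \<times> A" by (simp add: space_pair_measure)
  have "(\<lambda>w. distr (q (fst w) (snd w)) (borel_on Zn) Q) \<in> ?Mn \<rightarrow>\<^sub>M prob_algebra (borel_on Zn)"
  proof (rule measurable_compose[OF _ measurable_distr_prob_space[OF Q]])
    show "(\<lambda>w. q (fst w) (snd w)) \<in> ?Mn \<rightarrow>\<^sub>M prob_algebra (borel_on Z)"
      using measurable_compose[OF incl q_kernel] by (simp add: case_prod_beta')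
  qed
  then show "(\<lambda>(z, a). pn z a) \<in> ?Mn \<rightarrow>\<^sub>M prob_algebra (borel_on Zn)"
    by (subst measurable_cong[where g="\<lambda>w. distr (q (fst w) (snd w)) (borel_on Zn) Q"])
       (auto simp: sp finite_kernel_distr)
  have "(\<lambda>w. b (fst w) (snd w)) \<in> borel_measurable ?Mn"
    using measurable_compose[OF incl b_cost] by (simp add: case_prod_beta')
  then show "(\<lambda>(z, a). cn z a) \<in> borel_measurable ?Mn"
    by (subst measurable_cong[where g="\<lambda>w. b (fst w) (snd w)"]) (auto simp: sp Q_id)
  show "sets \<eta>n = sets (borel_on Zn)" by (simp add: \<eta>n_def)
  interpret \<eta>: finite_measure \<eta> by (rule \<eta>_finite)
  show "finite_measure \<eta>n" unfolding \<eta>n_def by (rule \<eta>.finite_measure_distr[OF Q_\<eta>])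
  have sp\<eta>: "space \<eta> = Z" using sets_eq_imp_space_eq[OF sets_\<eta>] by simp
  have "Q -` Zn \<inter> space \<eta> = Z" using sp\<eta> Q_in by auto
  then show "measure \<eta>n Zn = 1 - lam"
    unfolding \<eta>n_def using \<eta>_mass Zn by (subst measure_distr[OF Q_\<eta>]) (auto simp: sets_borel_on_finite)
  fix z a assume za: "z \<in> Zn" "a \<in> A"
  then have z: "z \<in> Z" using Zn by auto
  show "\<bar>cn z a\<bar> \<le> cb" using qm.cost_bound[OF z za(2)] za by (simp add: Q_id)
  note D = in_prob_algebraD[OF qm.p_in_prob_algebra[OF z za(2)]]
  have Qm: "Q \<in> q z a \<rightarrow>\<^sub>M borel_on Zn" unfolding measurable_cong_sets[OF D(2) refl] by (rule Q)
  fix B assume B: "B \<in> sets (borel_on Zn)"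
  have "Q -` B \<inter> Z \<in> sets (borel_on Z)" using measurable_sets[OF Q B] by simp
  then show "measure \<eta>n B \<le> measure (pn z a) B"
    unfolding \<eta>n_def finite_kernel_distr[OF za] measure_distr[OF Q_\<eta> B] measure_distr[OF Qm B] sp\<eta> D(3) space_borel_on
    by (rule qm.minor[OF z za(2)])
qed (use Zn A_borel A_nonempty lam in auto)

sublocale nm: minorized_MDP Zn A pn cn \<eta>n lam cb
  by (rule pn_minorized)

lemma integral_finite_kernel:
  fixes u :: "'z \<Rightarrow> real"
  assumes "z \<in> Z" "a \<in> A"
  shows "(\<integral>y. u y \<partial>pn (Q z) a) = (\<integral>x. u (Q x) \<partial>q z a)"
proof -
  have u: "u \<in> borel_measurable (borel_on Zn)" using Zn by (intro measurable_borel_on_finite) auto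
  note D = in_prob_algebraD[OF qm.p_in_prob_algebra[OF assms]]
  have Qm: "Q \<in> q z a \<rightarrow>\<^sub>M borel_on Zn" unfolding measurable_cong_sets[OF D(2) refl] by (rule Q)
  show ?thesis
    unfolding finite_kernel_distr[OF Q_in[OF assms(1)] assms(2)] q_Q[OF assms(1)]
    by (rule integral_distr[OF Qm u])
qed

lemma extend_policy:
  assumes "g \<in> det_stationary Zn A"
  shows "g \<circ> Q \<in> det_stationary Z A"
  using assms unfolding det_stationary_def by (rule measurable_comp[OF Q])

text \<open>The image under \<open>Q\<close> of the invariant measure of \<open>q\<close> is invariant for the finite model.\<close>

lemma ergodic_cost_extend:
  assumes g: "g \<in> det_stationary Zn A"
  shows "ergodic_cost Zn pn cn g = ergodic_cost Z q b (g \<circ> Q)"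
proof -
  note g' = extend_policy[OF g]
  let ?K = "\<lambda>x. q x ((g \<circ> Q) x)" and ?Kn = "\<lambda>y. pn y (g y)"
  interpret K: doeblin Z ?K \<eta> lam using g' by (rule qm.doeblin_policy)
  interpret Kn: doeblin Zn ?Kn \<eta>n lam using g by (rule nm.doeblin_policy)
  let ?\<mu> = "invariant_prob Z ?K"
  let ?m = "distr ?\<mu> (borel_on Zn) Q"
  note D = in_prob_algebraD[OF K.invariant_prob_space]
  have ne: "space ?\<mu> \<noteq> {}" using D(3) Z_nonempty by simp
  have Qm: "Q \<in> ?\<mu> \<rightarrow>\<^sub>M borel_on Zn" unfolding measurable_cong_sets[OF D(2) refl] by (rule Q)
  have m: "?m \<in> space (prob_algebra (borel_on Zn))"
    using prob_space.prob_space_distr[OF D(1) Qm] by (simp add: space_prob_algebra)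
  have "?m \<bind> ?Kn = ?\<mu> \<bind> (\<lambda>x. ?Kn (Q x))"
    by (rule bind_distr[OF Qm measurable_prob_algebraD[OF Kn.K] ne])
  also have "\<dots> = ?\<mu> \<bind> (\<lambda>x. distr (?K x) (borel_on Zn) Q)"
    using D(3) nm.det_stationary_in[OF g] Q_in
    by (intro bind_cong[OF refl]) (simp add: finite_kernel_distr q_Q)
  also have "\<dots> = distr (?\<mu> \<bind> ?K) (borel_on Zn) Q"
  proof (rule distr_bind[symmetric, OF _ ne Q])
    show "?K \<in> ?\<mu> \<rightarrow>\<^sub>M subprob_algebra (borel_on Z)"
      unfolding measurable_cong_sets[OF D(2) refl] by (rule measurable_prob_algebraD[OF K.K])
  qed
  finally have "?m \<bind> ?Kn = ?m"
    unfolding K.invariant_prob_bind .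
  with m have "invariant_prob Zn ?Kn = ?m"
    by (rule Kn.invariant_prob_eqI)
  then have "ergodic_cost Zn pn cn g = (\<integral>y. cn y (g y) \<partial>?m)"
    by (simp add: ergodic_cost_def)
  also have "\<dots> = (\<integral>x. cn (Q x) (g (Q x)) \<partial>?\<mu>)"
    by (rule integral_distr[OF Qm nm.policy_cost[OF g]])
  finally show ?thesis by (simp add: ergodic_cost_def)
qed

text \<open>A policy of the \<open>q\<close>-model need not be constant on cells, so it does not restrict to a policy
  of the finite model; the optimality equation makes up for that.\<close>

lemma finite_optimal_le:
  assumes g: "avg_optimal Zn A pn cn g" and f: "f \<in> det_stationary Z A"
  shows "ergodic_cost Z q b (g \<circ> Q) \<le> ergodic_cost Z q b f"
proof (rule field_le_epsilon)
  fix e :: real assume "0 < e"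
  then have "0 < e / 2" by simp
  obtain u r h where h: "h \<in> det_stationary Zn A"
    and lower: "\<And>x a. x \<in> Zn \<Longrightarrow> a \<in> A \<Longrightarrow> u x + (r - e / 2) \<le> cn x a + (\<integral>y. u y \<partial>pn x a)"
    and upper: "\<And>x. x \<in> Zn \<Longrightarrow> cn x (h x) + (\<integral>y. u y \<partial>pn x (h x)) \<le> u x + (r + e / 2)"
    by (rule nm.approximate_optimality_equation[OF Zn(2) \<open>0 < e / 2\<close>]) (rule that, assumption+)
  obtain B where B: "\<And>y. y \<in> Zn \<Longrightarrow> \<bar>u y\<bar> \<le> B"
    using finite_bounded_real[OF Zn(2), of u] by auto
  have um: "u \<in> borel_measurable (borel_on Zn)" using Zn by (intro measurable_borel_on_finite) auto
  have "ergodic_cost Z q b (g \<circ> Q) = ergodic_cost Zn pn cn g"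
    using g by (intro ergodic_cost_extend[symmetric]) (simp add: avg_optimal_def)
  also have "\<dots> \<le> ergodic_cost Zn pn cn h"
    by (rule nm.avg_optimal_ergodic_cost_le[OF g h])
  also have "\<dots> \<le> r + e / 2"
    by (rule nm.ergodic_cost_le[OF h um B upper])
  \<comment> \<open>The lower inequality holds for every action at the grid point of a cell, so also
    for the action that f takes at an arbitrary x of the cell. Hence \<open>u\<close> composed with
    \<open>Q\<close> is a test function for every policy on \<open>Z\<close>.\<close>
  also have "r - e / 2 \<le> ergodic_cost Z q b f"
  proof (rule qm.ergodic_cost_ge[OF f])
    show "(\<lambda>x. u (Q x)) \<in> borel_measurable (borel_on Z)" by (rule measurable_compose[OF Q um])
    show "\<bar>u (Q x)\<bar> \<le> B" if "x \<in> Z" for x using B Q_in[OF that] by blast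
    show "u (Q x) + (r - e / 2) \<le> b x (f x) + (\<integral>y. u (Q y) \<partial>q x (f x))" if "x \<in> Z" for x
      using lower[OF Q_in[OF that] det_stationary_in[OF f that]]
        integral_finite_kernel[OF that det_stationary_in[OF f that], of u] by simp
  qed
  then have "r + e / 2 \<le> ergodic_cost Z q b f + e" by simp
  finally show "ergodic_cost Z q b (g \<circ> Q) \<le> ergodic_cost Z q b f + e" .
qed

end

section \<open>Perturbation of the kernel\<close>

lemma (in prob_space) abs_integral_diff_const_le:
  fixes g :: "'a \<Rightarrow> real"
  assumes "integrable M g" "AE x in M. \<bar>g x - l\<bar> \<le> w"
  shows "\<bar>(\<integral>x. g x \<partial>M) - l\<bar> \<le> w"
proof -
  have "l - w \<le> (\<integral>x. g x \<partial>M)"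
    using assms(2) by (intro integral_ge_const assms(1)) (auto simp: abs_le_iff)
  moreover have "(\<integral>x. g x \<partial>M) \<le> l + w"
    using assms(2) by (intro integral_le_const assms(1)) (auto simp: abs_le_iff)
  ultimately show ?thesis by (simp add: abs_le_iff)
qed

text \<open>Write K^t K - L^t L as K^t (K - L) + (K^t - L^t) L. The first term costs one
  \<open>w\<close>; applying \<open>L\<close> in the second does not increase the distance, since
  the probabilities of a set under \<open>L\<close> have values in [0, 1].\<close>

lemma tv_dist_kernel_pow_le:
  assumes K: "K \<in> borel_on Z \<rightarrow>\<^sub>M prob_algebra (borel_on Z)" and L: "L \<in> borel_on Z \<rightarrow>\<^sub>M prob_algebra (borel_on Z)"
    and w: "\<And>x. x \<in> Z \<Longrightarrow> tv_dist (K x) (L x) \<le> w" and z: "z \<in> Z"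
  shows "tv_dist (kernel_pow Z K t z) (kernel_pow Z L t z) \<le> real t * w"
proof (induction t)
  case 0
  have "sets (borel_on Z) \<noteq> {}" using sets.empty_sets by blast
  then show ?case by (simp add: tv_dist_def)
next
  case (Suc t)
  let ?\<mu> = "kernel_pow Z K t z" and ?\<nu> = "kernel_pow Z L t z"
  have in_pow: "kernel_pow Z K t z \<in> space (prob_algebra (borel_on Z))"
    if "K \<in> borel_on Z \<rightarrow>\<^sub>M prob_algebra (borel_on Z)" for K t
    using measurable_space[OF kernel_pow_measurable[OF that]] z by simp
  note \<mu> = in_pow[OF K, of t] and \<nu> = in_pow[OF L, of t]
  note D = in_prob_algebraD[OF \<mu>]
  interpret \<mu>: prob_space ?\<mu> by (rule D(1))
  have Kx: "K x \<in> space (prob_algebra (borel_on Z))" "L x \<in> space (prob_algebra (borel_on Z))" if "x \<in> Z" for x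
    using measurable_space[OF K] measurable_space[OF L] that by simp_all
  show ?case
  proof (rule tv_dist_leI[OF in_pow[OF K] in_pow[OF L]])
    fix B assume B: "B \<in> sets (borel_on Z)"
    have m: "(\<lambda>x. measure (K x) B) \<in> borel_measurable (borel_on Z)" "(\<lambda>x. measure (L x) B) \<in> borel_measurable (borel_on Z)"
      using measurable_compose[OF K measurable_measure_prob_algebra[OF B]]
        measurable_compose[OF L measurable_measure_prob_algebra[OF B]] .
    have le1: "measure (K x) B \<le> 1" "measure (L x) B \<le> 1" if "x \<in> Z" for x
      using Kx[OF that] by (auto intro: prob_space.prob_le_1 in_prob_algebraD)
    have i: "integrable ?\<mu> (\<lambda>x. measure (K x) B)" "integrable ?\<mu> (\<lambda>x. measure (L x) B)"
      using m le1 D(3)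
      by (auto intro!: \<mu>.integral_abs_le(1)[where b=1] simp: measurable_cong_sets[OF D(2) refl])
    have "\<bar>(\<integral>x. measure (K x) B - measure (L x) B \<partial>?\<mu>) - 0\<bar> \<le> w / 2"
    proof (rule \<mu>.abs_integral_diff_const_le)
      show "AE x in ?\<mu>. \<bar>measure (K x) B - measure (L x) B - 0\<bar> \<le> w / 2"
      proof (rule AE_I2)
        fix x assume "x \<in> space ?\<mu>"
        then have x: "x \<in> Z" using D(3) by simp
        show "\<bar>measure (K x) B - measure (L x) B - 0\<bar> \<le> w / 2"
          using abs_measure_diff_le_tv[OF Kx[OF x] B] w[OF x] by simp
      qed
    qed (use i in simp)
    moreover have "\<bar>(\<integral>x. measure (L x) B \<partial>?\<mu>) - (\<integral>x. measure (L x) B \<partial>?\<nu>)\<bar> \<le> (1 - 0) / 2 * tv_dist ?\<mu> ?\<nu>"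
      using m(2) le1 by (intro abs_integral_diff_le_tv[OF \<mu> \<nu>]) auto
    then have "\<bar>(\<integral>x. measure (L x) B \<partial>?\<mu>) - (\<integral>x. measure (L x) B \<partial>?\<nu>)\<bar> \<le> real t * w / 2"
      using Suc by simp
    ultimately have "\<bar>(\<integral>x. measure (K x) B \<partial>?\<mu>) - (\<integral>x. measure (L x) B \<partial>?\<nu>)\<bar> \<le> w / 2 + real t * w / 2"
      using Bochner_Integration.integral_diff[OF i] by linarith
    then show "\<bar>measure (kernel_pow Z K (Suc t) z) B - measure (kernel_pow Z L (Suc t) z) B\<bar> \<le> real (Suc t) * w / 2"
      using measure_bind_prob[OF \<mu> K B] measure_bind_prob[OF \<nu> L B] by (simp add: algebra_simps add_divide_distrib)
  qed
qed

context quantized_MDP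
begin

text \<open>The row of \<open>q\<close> at z is a mixture of rows of \<open>p\<close> over the cell
  of z, and each of them is within \<open>wp\<close> of the row at z.\<close>

lemma tv_dist_averaged_kernel_le:
  assumes wp: "\<And>x y a. x \<in> Z \<Longrightarrow> y \<in> Z \<Longrightarrow> a \<in> A \<Longrightarrow> Q x = Q y \<Longrightarrow> tv_dist (p x a) (p y a) \<le> wp"
    and z: "z \<in> Z" and a: "a \<in> A"
  shows "tv_dist (p z a) (q z a) \<le> wp"
proof (rule tv_dist_leI[OF p_in_prob_algebra[OF z a] qm.p_in_prob_algebra[OF z a]])
  fix D assume D: "D \<in> sets (borel_on Z)"
  note E = in_prob_algebraD[OF cell_measure_in[OF Q_in[OF z]]]
  have "\<bar>(\<integral>x. measure (p x a) D \<partial>\<nu>c (Q z)) - measure (p z a) D\<bar> \<le> wp / 2"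
  proof (rule prob_space.abs_integral_diff_const_le[OF E(1) measure_p_meas(2)[OF Q_in[OF z] a D]])
    show "AE x in \<nu>c (Q z). \<bar>measure (p x a) D - measure (p z a) D\<bar> \<le> wp / 2"
      using AE_cell_in[OF z]
    proof eventually_elim
      case (elim x)
      then show ?case
        using abs_measure_diff_le_tv[OF p_in_prob_algebra[OF _ a] p_in_prob_algebra[OF z a] D, of x] wp[of x z a] z a
        by simp
    qed
  qed
  then show "\<bar>measure (p z a) D - measure (q z a) D\<bar> \<le> wp / 2"
    by (simp add: measure_q[OF z a D] abs_minus_commute)
qed

lemma abs_averaged_cost_diff_le:
  assumes wc: "\<And>x y a. x \<in> Z \<Longrightarrow> y \<in> Z \<Longrightarrow> a \<in> A \<Longrightarrow> Q x = Q y \<Longrightarrow> \<bar>c x a - c y a\<bar> \<le> wc"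
    and z: "z \<in> Z" and a: "a \<in> A"
  shows "\<bar>b z a - c z a\<bar> \<le> wc"
  unfolding finite_cost_def
proof (rule prob_space.abs_integral_diff_const_le)
  note E = in_prob_algebraD[OF cell_measure_in[OF Q_in[OF z]]]
  show "prob_space (\<nu>c (Q z))" by (rule E(1))
  have "(\<lambda>x. c x a) \<in> borel_measurable (\<nu>c (Q z))"
    unfolding measurable_cong_sets[OF E(2) refl] by (rule c_action[OF a])
  then show "integrable (\<nu>c (Q z)) (\<lambda>x. c x a)"
    using cost_bound[OF _ a] E(3) by (intro prob_space.integral_abs_le(1)[OF E(1), where b=cb]) auto
  show "AE x in \<nu>c (Q z). \<bar>c x a - c z a\<bar> \<le> wc"
    using AE_cell_in[OF z] by eventually_elim (use wc z a in auto)
qed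

text \<open>Keep the cost of f under \<open>c\<close> fixed and pass from the invariant measure of
  \<open>p\<close> to its t-step law, to the t-step law of \<open>q\<close>, and to the invariant
  measure of \<open>q\<close>; there exchange \<open>c\<close> for \<open>b\<close>. The two mixing
  steps cost cb * e each.\<close>

lemma ergodic_cost_averaged_diff_le:
  assumes f: "f \<in> det_stationary Z A"
    and wp: "\<And>x y a. x \<in> Z \<Longrightarrow> y \<in> Z \<Longrightarrow> a \<in> A \<Longrightarrow> Q x = Q y \<Longrightarrow> tv_dist (p x a) (p y a) \<le> wp"
    and wc: "\<And>x y a. x \<in> Z \<Longrightarrow> y \<in> Z \<Longrightarrow> a \<in> A \<Longrightarrow> Q x = Q y \<Longrightarrow> \<bar>c x a - c y a\<bar> \<le> wc"
    and ep: "\<And>z. z \<in> Z \<Longrightarrow> tv_dist (kernel_pow Z (\<lambda>x. p x (f x)) t z) (invariant_prob Z (\<lambda>x. p x (f x))) \<le> e"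
    and eq: "\<And>z. z \<in> Z \<Longrightarrow> tv_dist (kernel_pow Z (\<lambda>x. q x (f x)) t z) (invariant_prob Z (\<lambda>x. q x (f x))) \<le> e"
  shows "\<bar>ergodic_cost Z p c f - ergodic_cost Z q b f\<bar> \<le> 2 * cb * e + wc + cb * (real t * wp)"
proof -
  interpret P: doeblin Z "\<lambda>x. p x (f x)" \<eta> lam using f by (rule doeblin_policy)
  interpret Qc: doeblin Z "\<lambda>x. q x (f x)" \<eta> lam using f by (rule qm.doeblin_policy)
  let ?P = "\<lambda>x. p x (f x)" and ?Q = "\<lambda>x. q x (f x)"
  obtain z where z: "z \<in> Z" using Z_nonempty by auto
  have fA: "f x \<in> A" if "x \<in> Z" for x using det_stationary_in[OF f that] .
  have cb: "\<bar>c x (f x)\<bar> \<le> cb" if "x \<in> Z" for x using cost_bound[OF that fA[OF that]] .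
  then have "0 \<le> cb" using z by fastforce
  define g where "g = (\<lambda>x. c x (f x))"
  have g: "g \<in> borel_measurable (borel_on Z)" using policy_cost[OF f] by (simp add: g_def)
  \<comment> \<open>The factor \<open>cb\<close> is half the length of the interval [-cb, cb] that
    contains the values of \<open>g\<close>.\<close>
  have diff: "\<bar>(\<integral>x. g x \<partial>\<mu>1) - (\<integral>x. g x \<partial>\<mu>2)\<bar> \<le> cb * d"
    if "\<mu>1 \<in> space (prob_algebra (borel_on Z))" "\<mu>2 \<in> space (prob_algebra (borel_on Z))" "tv_dist \<mu>1 \<mu>2 \<le> d" for \<mu>1 \<mu>2 d
  proof -
    have "\<bar>(\<integral>x. g x \<partial>\<mu>1) - (\<integral>x. g x \<partial>\<mu>2)\<bar> \<le> (cb - (- cb)) / 2 * tv_dist \<mu>1 \<mu>2"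
      using cb \<open>0 \<le> cb\<close> by (intro abs_integral_diff_le_tv[OF that(1,2) g]) (force simp: g_def abs_le_iff)+
    also have "\<dots> \<le> cb * d" using that(3) \<open>0 \<le> cb\<close> by (simp add: mult_left_mono)
    finally show ?thesis .
  qed
  have "tv_dist (?P x) (?Q x) \<le> wp" if "x \<in> Z" for x
    using tv_dist_averaged_kernel_le[OF wp that fA[OF that]] .
  then have "tv_dist (kernel_pow Z ?P t z) (kernel_pow Z ?Q t z) \<le> real t * wp"
    by (rule tv_dist_kernel_pow_le[OF P.K Qc.K _ z])
  note 1 = diff[OF P.pow_space[OF z] Qc.pow_space[OF z] this]
  note 2 = diff[OF P.pow_space[OF z] P.invariant_prob_space ep[OF z]]
  note 3 = diff[OF Qc.pow_space[OF z] Qc.invariant_prob_space eq[OF z]]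
  let ?\<mu> = "invariant_prob Z ?Q"
  note D = in_prob_algebraD[OF Qc.invariant_prob_space]
  interpret \<mu>: prob_space ?\<mu> by (rule D(1))
  have m: "g \<in> borel_measurable ?\<mu>" "(\<lambda>x. b x (f x)) \<in> borel_measurable ?\<mu>"
    unfolding measurable_cong_sets[OF D(2) refl] using g qm.policy_cost[OF f] by auto
  have "\<bar>g x\<bar> \<le> cb" "\<bar>b x (f x)\<bar> \<le> cb" if "x \<in> space ?\<mu>" for x
    using that cb qm.cost_bound fA unfolding D(3) by (auto simp: g_def)
  then have i: "integrable ?\<mu> g" "integrable ?\<mu> (\<lambda>x. b x (f x))"
    by (auto intro!: \<mu>.integral_abs_le(1)[where b=cb] m)
  have "\<bar>(\<integral>x. b x (f x) - g x \<partial>?\<mu>) - 0\<bar> \<le> wc"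
  proof (rule \<mu>.abs_integral_diff_const_le)
    show "AE x in ?\<mu>. \<bar>b x (f x) - g x - 0\<bar> \<le> wc"
    proof (rule AE_I2)
      fix x assume "x \<in> space ?\<mu>"
      then have x: "x \<in> Z" using D(3) by simp
      show "\<bar>b x (f x) - g x - 0\<bar> \<le> wc"
        unfolding g_def diff_0_right by (rule abs_averaged_cost_diff_le[OF wc x fA[OF x]])
    qed
  qed (use i in simp)
  then have 4: "\<bar>(\<integral>x. b x (f x) \<partial>?\<mu>) - (\<integral>x. g x \<partial>?\<mu>)\<bar> \<le> wc" using i by simp
  have "ergodic_cost Z p c f = (\<integral>x. g x \<partial>invariant_prob Z ?P)" "ergodic_cost Z q b f = (\<integral>x. b x (f x) \<partial>?\<mu>)"
    by (simp_all add: ergodic_cost_def g_def)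
  with 1 2 3 4 show ?thesis by (simp add: abs_le_iff)
qed

end

theorem theorem5p3:
  fixes Z :: "'z::euclidean_space set" and A :: "'a::polish_space set"
    and p :: "'z \<Rightarrow> 'a \<Rightarrow> 'z measure" and c :: "'z \<Rightarrow> 'a \<Rightarrow> real"
    and \<zeta> :: "'z measure" and \<theta> :: "'z \<Rightarrow> 'a \<Rightarrow> real"
    and lam \<alpha> R \<kappa> :: real
    and Zn :: "nat \<Rightarrow> 'z set" and Q :: "nat \<Rightarrow> 'z \<Rightarrow> 'z" and \<nu> :: "nat \<Rightarrow> 'z measure"
    and fstar :: "'z \<Rightarrow> 'a" and fn :: "nat \<Rightarrow> 'z \<Rightarrow> 'a"
  assumes mdp: "MDP Z A p c"
    and A_compact: "compact A"
    and Z_compact: "compact Z" and Z_infinite: "infinite Z"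
    and c_cont: "continuous_on (Z \<times> A) (\<lambda>(z, a). c z a)"
    and c_bdd: "bounded ((\<lambda>(z, a). c z a) ` (Z \<times> A))"
    and p_cont: "tv_continuous Z A p"
    and \<zeta>: "finite_measure \<zeta>" "sets \<zeta> = sets (borel_on Z)" "measure \<zeta> Z > 0"
    and \<theta>: "(\<lambda>(z, a). \<theta> z a) \<in> borel_on Z \<Otimes>\<^sub>M borel_on A \<rightarrow>\<^sub>M borel"
      "\<And>z a. z \<in> Z \<Longrightarrow> a \<in> A \<Longrightarrow> \<theta> z a \<ge> 0"
    and lam: "0 < lam" "lam < 1"
    and minorization: "\<And>z a B. z \<in> Z \<Longrightarrow> a \<in> A \<Longrightarrow> B \<in> sets (borel_on Z) \<Longrightarrow>
        measure (p z a) B \<ge> measure \<zeta> B * \<theta> z a"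
      "\<And>z a. z \<in> Z \<Longrightarrow> a \<in> A \<Longrightarrow> (1 - lam) / measure \<zeta> Z \<le> \<theta> z a"
    and \<alpha>: "\<alpha> > 0"
    and grid: "\<And>n. n \<ge> 1 \<Longrightarrow> Zn n \<subseteq> Z \<and> finite (Zn n) \<and> card (Zn n) = n"
    and covering: "\<And>n z. n \<ge> 1 \<Longrightarrow> z \<in> Z \<Longrightarrow>
        (MIN y\<in>Zn n. dist z y) \<le> \<alpha> * (1 / real n) powr (1 / real DIM('z))"
    and Q: "\<And>n. n \<ge> 1 \<Longrightarrow> nearest_neighbour_map Z (Zn n) (Q n)"
    and \<nu>: "\<And>n. n \<ge> 1 \<Longrightarrow> \<nu> n \<in> space (prob_algebra (borel_on Z))"
      "\<And>n y. n \<ge> 1 \<Longrightarrow> y \<in> Zn n \<Longrightarrow> measure (\<nu> n) (cell Z (Q n) y) > 0"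
    and fstar: "avg_optimal Z A p c fstar"
    and fn: "\<And>n. n \<ge> 1 \<Longrightarrow> avg_optimal (Zn n) A
        (finite_kernel Z (Zn n) (Q n) (\<nu> n) p) (finite_cost Z (Q n) (\<nu> n) c) (fn n)"
    and R: "R > 0" and \<kappa>: "0 < \<kappa>" "\<kappa> < 1"
    and ergodic_p: "\<And>f z t. f \<in> det_stationary Z A \<Longrightarrow> z \<in> Z \<Longrightarrow> t \<ge> 1 \<Longrightarrow>
        tv_dist (kernel_pow Z (\<lambda>x. p x (f x)) t z) (invariant_prob Z (\<lambda>x. p x (f x)))
          \<le> R * \<kappa> ^ t"
    and ergodic_q: "\<And>n f z t. n \<ge> 1 \<Longrightarrow> f \<in> det_stationary Z A \<Longrightarrow> z \<in> Z \<Longrightarrow> t \<ge> 1 \<Longrightarrow>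
        tv_dist (kernel_pow Z (\<lambda>x. averaged_kernel Z (Q n) (\<nu> n) p x (f x)) t z)
          (invariant_prob Z (\<lambda>x. averaged_kernel Z (Q n) (\<nu> n) p x (f x)))
          \<le> R * \<kappa> ^ t"
  shows "\<forall>n\<ge>1. \<forall>t\<ge>1. let d = 2 * \<alpha> * (1 / real n) powr (1 / real DIM('z)) in
     \<bar>ergodic_cost Z p c (fn n \<circ> Q n) - ergodic_cost Z p c fstar\<bar>
       \<le> 4 * sup_norm Z A c * R * \<kappa> ^ t + 2 * modulus_cost Z A c d
         + 2 * sup_norm Z A c * real t * modulus_kernel Z A p d"
proof (intro allI impI)
  fix n t :: nat assume n: "1 \<le> n" and t: "1 \<le> t"
  interpret MDP Z A p c by (rule mdp)
  \<comment> \<open>A bound on the covering radius. Two points of a cell are both within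
    \<open>h\<close> of its grid point, so 2 * h bounds their distance.\<close>
  define h where "h = \<alpha> * (1 / real n) powr (1 / real DIM('z))"
  define cb where "cb = sup_norm Z A c"
  define wc where "wc = modulus_cost Z A c (2 * h)"
  define wp where "wp = modulus_kernel Z A p (2 * h)"
  \<comment> \<open>\<open>s\<close> is the uniform lower bound on \<theta>: with it
    \<open>\<eta>\<close> lies below every \<open>p z a\<close> and has total mass 1 - lam.\<close>
  define s where "s = (1 - lam) / measure \<zeta> Z"
  define \<eta> where "\<eta> = scale_measure (ennreal s) \<zeta>"
  interpret \<zeta>: finite_measure \<zeta> by (rule \<zeta>(1))
  have s: "0 < s" using lam \<zeta>(3) by (simp add: s_def)
  have \<eta>: "measure \<eta> B = s * measure \<zeta> B" for B
    using s by (simp add: \<eta>_def measure_scale_measure)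
  have sp\<zeta>: "space \<zeta> = Z" using sets_eq_imp_space_eq[OF \<zeta>(2)] by simp
  have cb: "\<bar>c z a\<bar> \<le> cb" if "z \<in> Z" "a \<in> A" for z a
  proof -
    obtain B where "\<And>x. x \<in> (\<lambda>(z, a). c z a) ` (Z \<times> A) \<Longrightarrow> norm x \<le> B"
      using c_bdd unfolding bounded_iff by blast
    \<comment> \<open>A real-valued supremum bounds its terms only once boundedness is known; the
      two moduli below require the same check.\<close>
    then have "bdd_above ((\<lambda>(z, a). \<bar>c z a\<bar>) ` (Z \<times> A))" by (intro bdd_aboveI2[where M=B]) force
    from cSUP_upper[OF _ this, of "(z, a)"] that show ?thesis by (simp add: cb_def sup_norm_def)
  qed
  interpret minorized_MDP Z A p c \<eta> lam cb
  proof (intro minorized_MDP.intro mdp minorized_MDP_axioms.intro)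
    show "sets \<eta> = sets (borel_on Z)" using \<zeta>(2) by (simp add: \<eta>_def)
    show "finite_measure \<eta>"
      by (rule finite_measureI) (simp add: \<eta>_def ennreal_mult_eq_top_iff)
    show "measure \<eta> Z = 1 - lam" using \<zeta>(3) by (simp add: \<eta> s_def)
    show "measure \<eta> B \<le> measure (p z a) B" if "z \<in> Z" "a \<in> A" "B \<in> sets (borel_on Z)" for z a B
    proof -
      have "measure \<zeta> B * s \<le> measure \<zeta> B * \<theta> z a"
        using minorization(2)[OF that(1,2)] by (intro mult_left_mono) (simp_all add: s_def)
      also have "\<dots> \<le> measure (p z a) B" by (rule minorization(1)[OF that])
      finally show ?thesis by (simp add: \<eta> mult.commute)
    qed
  qed (use lam cb in auto)
  have Zn: "Zn n \<subseteq> Z" "finite (Zn n)" "Zn n \<noteq> {}" using grid[OF n] n by auto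
  note nn = Q[OF n, unfolded nearest_neighbour_map_def]
  have near: "dist z (Q n z) \<le> h" if "z \<in> Z" for z
    using nn that covering[OF n that] by (simp add: h_def)
  have "0 \<le> h" using \<alpha> by (simp add: h_def)
  have Q_id: "Q n y = y" if y: "y \<in> Zn n" for y
  proof -
    have "dist y (Q n y) = (MIN w\<in>Zn n. dist y w)" using nn y Zn by auto
    also have "\<dots> \<le> dist y y" using y Zn by (intro Min_le) auto
    finally show ?thesis by simp
  qed
  interpret quantized_MDP Z A p c \<eta> lam cb "Zn n" "Q n" "\<nu> n"
    using Zn Q_id nn \<nu>[OF n]
    by (intro quantized_MDP.intro quantized_MDP_axioms.intro minorized_MDP_axioms) auto
  have cell_dist: "dist x y \<le> 2 * h" if "x \<in> Z" "y \<in> Z" "Q n x = Q n y" for x y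
    using near[OF that(1)] near[OF that(2)] that(3) dist_triangle2[of x y "Q n x"] by simp
  have wc: "\<bar>c x a - c y a\<bar> \<le> wc" if xy: "x \<in> Z" "y \<in> Z" "a \<in> A" "Q n x = Q n y" for x y a
  proof -
    let ?S = "{(a, z, y). a \<in> A \<and> z \<in> Z \<and> y \<in> Z \<and> dist z y \<le> 2 * h}"
    have "bdd_above ((\<lambda>(a, z, y). \<bar>c z a - c y a\<bar>) ` ?S)"
    proof (rule bdd_aboveI2[where M="2 * cb"], clarsimp)
      fix a z y assume "a \<in> A" "z \<in> Z" "y \<in> Z"
      then show "\<bar>c z a - c y a\<bar> \<le> 2 * cb" using cb[of z a] cb[of y a] by linarith
    qed
    from cSUP_upper[OF _ this, of "(a, x, y)"] show ?thesis
      using xy cell_dist[OF xy(1,2,4)] by (simp add: wc_def modulus_cost_def)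
  qed
  have wp: "tv_dist (p x a) (p y a) \<le> wp" if xy: "x \<in> Z" "y \<in> Z" "a \<in> A" "Q n x = Q n y" for x y a
  proof -
    let ?S = "{(a, z, y). a \<in> A \<and> z \<in> Z \<and> y \<in> Z \<and> dist z y \<le> 2 * h}"
    have "bdd_above ((\<lambda>(a, z, y). tv_dist (p z a) (p y a)) ` ?S)"
      by (rule bdd_aboveI2[where M=2], clarsimp) (rule tv_dist_le_2[OF p_in_prob_algebra p_in_prob_algebra])
    from cSUP_upper[OF _ this, of "(a, x, y)"] show ?thesis
      using xy cell_dist[OF xy(1,2,4)] by (simp add: wp_def modulus_kernel_def)
  qed
  let ?g = "fn n \<circ> Q n"
  have fn: "avg_optimal (Zn n) A pn cn (fn n)" by (rule fn[OF n])
  then have g: "?g \<in> det_stationary Z A" by (intro extend_policy) (simp add: avg_optimal_def)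
  have f: "fstar \<in> det_stationary Z A" using fstar by (simp add: avg_optimal_def)
  have pert: "\<bar>ergodic_cost Z p c f - ergodic_cost Z q b f\<bar> \<le> 2 * cb * (R * \<kappa> ^ t) + wc + cb * (real t * wp)"
    if "f \<in> det_stationary Z A" for f
    by (rule ergodic_cost_averaged_diff_le[OF that wp wc ergodic_p[OF that _ t] ergodic_q[OF n that _ t]])
  \<comment> \<open>The difference of the two original costs is nonnegative by optimality of
    \<open>fstar\<close>. Passing through the averaged model at \<open>?g\<close> and at
    \<open>fstar\<close> splits it into two perturbation errors and a middle term that is at most
    zero.\<close>
  have "ergodic_cost Z p c fstar \<le> ergodic_cost Z p c ?g"
    by (rule avg_optimal_ergodic_cost_le[OF fstar g])
  moreover have "ergodic_cost Z q b ?g \<le> ergodic_cost Z q b fstar"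
    by (rule finite_optimal_le[OF fn f])
  ultimately have "\<bar>ergodic_cost Z p c ?g - ergodic_cost Z p c fstar\<bar>
      \<le> 2 * (2 * cb * (R * \<kappa> ^ t) + wc + cb * (real t * wp))"
    using pert[OF g] pert[OF f] by (simp add: abs_le_iff)
  then show "let d = 2 * \<alpha> * (1 / real n) powr (1 / real DIM('z)) in
     \<bar>ergodic_cost Z p c ?g - ergodic_cost Z p c fstar\<bar>
       \<le> 4 * sup_norm Z A c * R * \<kappa> ^ t + 2 * modulus_cost Z A c d
         + 2 * sup_norm Z A c * real t * modulus_kernel Z A p d"
    by (simp add: Let_def cb_def wc_def wp_def h_def algebra_simps)
qed

end
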